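(* Let $(X,d,\mu,\mathcal E,\mathcal F)$ be a strongly local regular Dirichlet space with generator $L$ and heat semigroup $P_t=e^{tL}$. Let $0<s<1$, $a=1-2s$, and $f\in\mathcal D((-L)^s)$. Consider the boundary value problem $$(L+\mathcal B_a)U=0\ \text{ in } X\times(0,\infty),\qquad U(\cdot,0)=f,\qquad \mathcal B_a=\frac{\partial^2}{\partial y^2}+\frac ay\frac{\partial}{\partial y}. \tag{P}$$ Then: (i) The function $$U(\cdot,y)=\frac1{\Gamma(s)}\int_0^{\infty}\big(P_t(-L)^sf\big)\,e^{-\frac{y^2}{4t}}\frac{dt}{t^{1-s}}$$ is a weak solution of (P). (ii) The Poisson formula $$U(\cdot,y)=\frac{y^{2s}}{2^{2s}\Gamma(s)}\int_0^\infty (P_tf)\,e^{-\frac{y^2}{4t}}\frac{dt}{t^{1+s}}$$ holds in the weak sense. (iii) The Dirichlet-to-Neumann condition holds weakly: $$(-L)^sf=-\frac{2^{2s-1}\Gamma(s)}{\Gamma(1-s)}\lim_{y\to0^+}y^a\frac{\partial U}{\partial y}(\cdot,y).$$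
   Context: $(X,d)$ is a locally compact, complete, separable metric space with a Radon measure $\mu$ of full support, and $(\mathcal E,\mathcal F)$ is a strongly local regular Dirichlet form on $L^2(X,\mu)$. Its generator $L$ is the non-positive self-adjoint operator with $\mathcal F=\mathcal D(\sqrt{-L})$, $\mathcal E(u,v)=\langle\sqrt{-L}u,\sqrt{-L}v\rangle$. With the spectral resolution $-L=\int_0^\infty\lambda\,dE(\lambda)$, one sets $\langle(-L)^sf,g\rangle=\int_0^\infty\lambda^s\,dE_{f,g}(\lambda)$ with $\mathcal D((-L)^s)=\{u\in\mathcal F:\int_0^\infty\lambda^{2s}dE_{u,u}(\lambda)<\infty\}$. The product $X\times(0,\infty)$ carries the measure $d\mu_a=d\mu\otimes y^a\,dy$. Weak sense: all identities, integrals, $y$-derivatives and limits are understood after pairing in $L^2(X,\mu)$ with an arbitrary $g\in L^2(X,\mu)$. Thus $U(\cdot,y)\in L^2(X,\mu)$ is defined by $\langle U(\cdot,y),g\rangle=\frac1{\Gamma(s)}\int_0^\infty\langle P_t(-L)^sf,g\rangle e^{-y^2/(4t)}\frac{dt}{t^{1-s}}$ for all $g$. That $U$ is a weak solution of (P) means: for $y>0$, $U(\cdot,y)\in\mathcal D(L)$ and, for every $g\in L^2(X,\mu)$, $\langle LU(\cdot,y),g\rangle+\mathcal B_a\langle U(\cdot,y),g\rangle=0$, and $\lim_{y\to0^+}\langle U(\cdot,y),g\rangle=\langle f,g\rangle$. Statement (iii) means $\langle(-L)^sf,g\rangle=-\frac{2^{2s-1}\Gamma(s)}{\Gamma(1-s)}\lim_{y\to0^+}y^a\frac{\partial}{\partial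 y}\langle U(\cdot,y),g\rangle$ for every $g\in L^2(X,\mu)$.
   Formalization: The boundary condition U(·,0)=f in (i) and the Poisson formula (ii) are stated only for f orthogonal to ker L; they fail otherwise (e.g. X compact, f=1 gives U=0). The equation (L+B_a)U=0 and (iii) are stated for all f in D((-L)^s). *)

theory Defs
  imports "HOL-Analysis.Analysis"
begin

section \<open>The underlying metric measure space\<close>

text \<open>
  The class \<^class>\<open>polish_space\<close> provides a complete metric with a countable base of open sets,
  i.e. a complete separable metric space.
\<close>

locale metric_radon_space =
  fixes M :: "'a::polish_space measure"
  assumes locally_compact: "locally compact (UNIV :: 'a set)"
    and sets_borel: "sets M = sets borel"
    and finite_on_compact: "\<And>K. compact K \<Longrightarrow> emeasure M K < \<infinity>"
    and outer_regular: "\<And>B. B \<in> sets borel \<Longrightarrow>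
          emeasure M B = (INF U\<in>{U. open U \<and> B \<subseteq> U}. emeasure M U)"
    and inner_regular: "\<And>U. open U \<Longrightarrow>
          emeasure M U = (SUP K\<in>{K. compact K \<and> K \<subseteq> U}. emeasure M K)"
    and full_support: "\<And>U. open U \<Longrightarrow> U \<noteq> {} \<Longrightarrow> 0 < emeasure M U"


section \<open>The real space \<open>L\<^sup>2\<close>\<close>

text \<open>
  Elements of \<open>L\<^sup>2\<close> are represented by square integrable functions; there is no quotient type,
  so every identity between elements is stated almost everywhere.
\<close>

definition L2 :: "'a measure \<Rightarrow> ('a \<Rightarrow> real) set" where
  "L2 M = {u \<in> borel_measurable M. integrable M (\<lambda>x. (u x)\<^sup>2)}"

definition ip :: "'a measure \<Rightarrow> ('a \<Rightarrow> real) \<Rightarrow> ('a \<Rightarrow> real) \<Rightarrow> real" where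
  "ip M u v = (LINT x|M. u x * v x)"

definition subspace_L2 :: "'a measure \<Rightarrow> ('a \<Rightarrow> real) set \<Rightarrow> bool" where
  "subspace_L2 M D \<longleftrightarrow>
     D \<subseteq> L2 M \<and> (\<lambda>x. 0) \<in> D \<and>
     (\<forall>u\<in>D. \<forall>v\<in>D. (\<lambda>x. u x + v x) \<in> D) \<and>
     (\<forall>c. \<forall>u\<in>D. (\<lambda>x. c * u x) \<in> D) \<and>
     (\<forall>u\<in>D. \<forall>v\<in>L2 M. (AE x in M. u x = v x) \<longrightarrow> v \<in> D)"

definition dense_L2 :: "'a measure \<Rightarrow> ('a \<Rightarrow> real) set \<Rightarrow> bool" where
  "dense_L2 M D \<longleftrightarrow>
     (\<forall>u\<in>L2 M. \<forall>\<epsilon>>0. \<exists>v\<in>D. ip M (\<lambda>x. u x - v x) (\<lambda>x. u x - v x) < \<epsilon>)"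

definition linear_L2 ::
  "'a measure \<Rightarrow> ('a \<Rightarrow> real) set \<Rightarrow> (('a \<Rightarrow> real) \<Rightarrow> ('a \<Rightarrow> real)) \<Rightarrow> bool" where
  "linear_L2 M D T \<longleftrightarrow>
     subspace_L2 M D \<and> (\<forall>u\<in>D. T u \<in> L2 M) \<and>
     (\<forall>u\<in>D. \<forall>v\<in>D. (AE x in M. u x = v x) \<longrightarrow> (AE x in M. T u x = T v x)) \<and>
     (\<forall>b c. \<forall>u\<in>D. \<forall>v\<in>D.
        AE x in M. T (\<lambda>x. b * u x + c * v x) x = b * T u x + c * T v x)"

text \<open>
  In \<open>self_adjoint\<close> the left-hand side of the equivalence says that \<open>v\<close> is in the domain of the
  adjoint of \<open>T\<close>, with value \<open>h\<close>; so \<open>T\<close> and its adjoint have the same domain and values.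
\<close>

definition self_adjoint ::
  "'a measure \<Rightarrow> ('a \<Rightarrow> real) set \<Rightarrow> (('a \<Rightarrow> real) \<Rightarrow> ('a \<Rightarrow> real)) \<Rightarrow> bool" where
  "self_adjoint M D T \<longleftrightarrow>
     linear_L2 M D T \<and> dense_L2 M D \<and>
     (\<forall>v\<in>L2 M. \<forall>h\<in>L2 M.
        (\<forall>u\<in>D. ip M (T u) v = ip M u h) \<longleftrightarrow> v \<in> D \<and> (AE x in M. T v x = h x))"


section \<open>Strongly local regular Dirichlet forms\<close>

definition C_c :: "('a::topological_space \<Rightarrow> real) set" where
  "C_c = {u. continuous_on UNIV u \<and> compact (closure {x. u x \<noteq> 0})}"

text \<open>
  The support of an element of \<open>L\<^sup>2\<close>: the complement of the largest open set on which it
  vanishes almost everywhere.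
\<close>

definition supp_L2 :: "'a::topological_space measure \<Rightarrow> ('a \<Rightarrow> real) \<Rightarrow> 'a set" where
  "supp_L2 M u = - \<Union>{V. open V \<and> (AE x in M. x \<in> V \<longrightarrow> u x = 0)}"

text \<open>The squared graph norm of the form.\<close>

definition form_norm1 ::
  "'a measure \<Rightarrow> (('a \<Rightarrow> real) \<Rightarrow> ('a \<Rightarrow> real) \<Rightarrow> real) \<Rightarrow> ('a \<Rightarrow> real) \<Rightarrow> real" where
  "form_norm1 M \<E> u = \<E> u u + ip M u u"

locale dirichlet_form = metric_radon_space M
  for M :: "'a::polish_space measure" +
  fixes \<F> :: "('a \<Rightarrow> real) set"
    and \<E> :: "('a \<Rightarrow> real) \<Rightarrow> ('a \<Rightarrow> real) \<Rightarrow> real"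
  assumes domain_subspace: "subspace_L2 M \<F>"
    and domain_dense: "dense_L2 M \<F>"
    and form_AE_cong: "\<And>u v w. u \<in> \<F> \<Longrightarrow> v \<in> \<F> \<Longrightarrow> w \<in> \<F> \<Longrightarrow>
          (AE x in M. u x = v x) \<Longrightarrow> \<E> u w = \<E> v w"
    and form_linear: "\<And>b c u v w. u \<in> \<F> \<Longrightarrow> v \<in> \<F> \<Longrightarrow> w \<in> \<F> \<Longrightarrow>
          \<E> (\<lambda>x. b * u x + c * v x) w = b * \<E> u w + c * \<E> v w"
    and form_symmetric: "\<And>u v. u \<in> \<F> \<Longrightarrow> v \<in> \<F> \<Longrightarrow> \<E> u v = \<E> v u"
    and form_nonneg: "\<And>u. u \<in> \<F> \<Longrightarrow> 0 \<le> \<E> u u"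
    and form_closed: "\<And>u :: nat \<Rightarrow> 'a \<Rightarrow> real. (\<And>n. u n \<in> \<F>) \<Longrightarrow>
          (\<forall>\<epsilon>>0. \<exists>N. \<forall>m\<ge>N. \<forall>n\<ge>N. form_norm1 M \<E> (\<lambda>x. u m x - u n x) < \<epsilon>) \<Longrightarrow>
          \<exists>v\<in>\<F>. (\<lambda>n. form_norm1 M \<E> (\<lambda>x. u n x - v x)) \<longlonglongrightarrow> 0"
    and form_markov: "\<And>u. u \<in> \<F> \<Longrightarrow>
          (\<lambda>x. min 1 (max 0 (u x))) \<in> \<F> \<and>
          \<E> (\<lambda>x. min 1 (max 0 (u x))) (\<lambda>x. min 1 (max 0 (u x))) \<le> \<E> u u"

locale strongly_local_regular_dirichlet_form = dirichlet_form +
  assumes core_dense_form: "\<And>u \<epsilon>. u \<in> \<F> \<Longrightarrow> 0 < \<epsilon> \<Longrightarrow>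
          \<exists>v\<in>\<F> \<inter> C_c. form_norm1 M \<E> (\<lambda>x. u x - v x) < \<epsilon>"
    and core_dense_uniform: "\<And>u \<epsilon>. u \<in> C_c \<Longrightarrow> 0 < \<epsilon> \<Longrightarrow>
          \<exists>v\<in>\<F> \<inter> C_c. \<forall>x. \<bar>u x - v x\<bar> < \<epsilon>"
    and strongly_local: "\<And>u v V c. u \<in> \<F> \<Longrightarrow> v \<in> \<F> \<Longrightarrow>
          compact (supp_L2 M u) \<Longrightarrow> compact (supp_L2 M v) \<Longrightarrow>
          open V \<Longrightarrow> supp_L2 M u \<subseteq> V \<Longrightarrow> (AE x in M. x \<in> V \<longrightarrow> v x = c) \<Longrightarrow> \<E> u v = 0"


section \<open>Spectral calculus\<close>

text \<open>
  A resolution of the identity of \<open>L\<^sup>2\<close> carried by \<open>[0,\<infinity>)\<close>, given as a projection valued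
  measure: \<open>Q B\<close> is the spectral projection of the Borel set \<open>B\<close>, and
  \<open>E\<^sub>u\<^sub>,\<^sub>v(B) = \<langle>Q B u, v\<rangle>\<close>.
\<close>

definition resolution_of_identity ::
  "'a measure \<Rightarrow> (real set \<Rightarrow> ('a \<Rightarrow> real) \<Rightarrow> ('a \<Rightarrow> real)) \<Rightarrow> bool" where
  "resolution_of_identity M Q \<longleftrightarrow>
     (\<forall>B\<in>sets borel. linear_L2 M (L2 M) (Q B)) \<and>
     (\<forall>B\<in>sets borel. \<forall>u\<in>L2 M. \<forall>v\<in>L2 M. ip M (Q B u) v = ip M u (Q B v)) \<and>
     (\<forall>B\<in>sets borel. \<forall>C\<in>sets borel. \<forall>u\<in>L2 M. AE x in M. Q (B \<inter> C) u x = Q B (Q C u) x) \<and>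
     (\<forall>u\<in>L2 M. AE x in M. Q {0..} u x = u x) \<and>
     (\<forall>B :: nat \<Rightarrow> real set. range B \<subseteq> sets borel \<longrightarrow> disjoint_family B \<longrightarrow>
        (\<forall>u\<in>L2 M. \<forall>v\<in>L2 M. (\<lambda>n. ip M (Q (B n) u) v) sums ip M (Q (\<Union>n. B n) u) v))"

text \<open>
  Integration against a real valued (signed) Borel measure \<open>\<nu>\<close> by its Jordan decomposition:
  the positive variation is \<open>\<nu>\<^sup>+(B) = sup {\<nu>(C). C \<subseteq> B}\<close>. The function \<^const>\<open>ennreal\<close> sends
  negative reals to 0, which is harmless because the empty set is among the \<open>C\<close>.
\<close>

definition positive_variation :: "(real set \<Rightarrow> real) \<Rightarrow> real measure" where
  "positive_variation \<nu> =
     measure_of UNIV (sets borel) (\<lambda>B. SUP C\<in>{C \<in> sets borel. C \<subseteq> B}. ennreal (\<nu> C))"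

definition signed_integral :: "(real set \<Rightarrow> real) \<Rightarrow> (real \<Rightarrow> real) \<Rightarrow> real" where
  "signed_integral \<nu> \<phi> =
     (LINT l|positive_variation \<nu>. \<phi> l) - (LINT l|positive_variation (\<lambda>B. - \<nu> B). \<phi> l)"

definition spectral_integral ::
  "'a measure \<Rightarrow> (real set \<Rightarrow> ('a \<Rightarrow> real) \<Rightarrow> ('a \<Rightarrow> real)) \<Rightarrow> (real \<Rightarrow> real) \<Rightarrow>
     ('a \<Rightarrow> real) \<Rightarrow> ('a \<Rightarrow> real) \<Rightarrow> real" where
  "spectral_integral M Q \<phi> u v = signed_integral (\<lambda>B. ip M (Q B u) v) \<phi>"

definition spectral_measure ::
  "'a measure \<Rightarrow> (real set \<Rightarrow> ('a \<Rightarrow> real) \<Rightarrow> ('a \<Rightarrow> real)) \<Rightarrow> ('a \<Rightarrow> real) \<Rightarrow> real measure" where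
  "spectral_measure M Q u = measure_of UNIV (sets borel) (\<lambda>B. ennreal (ip M (Q B u) u))"

definition spectral_domain ::
  "'a measure \<Rightarrow> (real set \<Rightarrow> ('a \<Rightarrow> real) \<Rightarrow> ('a \<Rightarrow> real)) \<Rightarrow> (real \<Rightarrow> real) \<Rightarrow>
     ('a \<Rightarrow> real) set" where
  "spectral_domain M Q \<phi> =
     {u \<in> L2 M. (\<integral>\<^sup>+ l. ennreal ((\<phi> l)\<^sup>2) \<partial>spectral_measure M Q u) < \<infinity>}"

text \<open>
  The operator \<open>\<integral> \<phi>(\<lambda>) dE(\<lambda>)\<close>: a representative of the element of \<open>L\<^sup>2\<close> determined almost
  everywhere by its pairings.
\<close>

definition spectral_op ::
  "'a measure \<Rightarrow> (real set \<Rightarrow> ('a \<Rightarrow> real) \<Rightarrow> ('a \<Rightarrow> real)) \<Rightarrow> (real \<Rightarrow> real) \<Rightarrow>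
     ('a \<Rightarrow> real) \<Rightarrow> ('a \<Rightarrow> real)" where
  "spectral_op M Q \<phi> u =
     (SOME h. h \<in> L2 M \<and> (\<forall>g\<in>L2 M. ip M h g = spectral_integral M Q \<phi> u g))"

definition spectral_resolution ::
  "'a measure \<Rightarrow> ('a \<Rightarrow> real) set \<Rightarrow> (('a \<Rightarrow> real) \<Rightarrow> ('a \<Rightarrow> real)) \<Rightarrow>
     (real set \<Rightarrow> ('a \<Rightarrow> real) \<Rightarrow> ('a \<Rightarrow> real)) \<Rightarrow> bool" where
  "spectral_resolution M D T Q \<longleftrightarrow>
     resolution_of_identity M Q \<and> D = spectral_domain M Q (\<lambda>l. l) \<and>
     (\<forall>u\<in>D. \<forall>g\<in>L2 M. ip M (T u) g = spectral_integral M Q (\<lambda>l. l) u g)"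


section \<open>Generator, heat semigroup and fractional powers\<close>

text \<open>
  \<open>L\<close> with domain \<open>D\<close> is the generator of the form, and \<open>Q\<close> is the spectral resolution of \<open>-L\<close>,
  which is used to define \<open>\<surd>(-L)\<close>.
\<close>

definition generator ::
  "'a measure \<Rightarrow> ('a \<Rightarrow> real) set \<Rightarrow> (('a \<Rightarrow> real) \<Rightarrow> ('a \<Rightarrow> real) \<Rightarrow> real) \<Rightarrow>
     ('a \<Rightarrow> real) set \<Rightarrow> (('a \<Rightarrow> real) \<Rightarrow> ('a \<Rightarrow> real)) \<Rightarrow>
     (real set \<Rightarrow> ('a \<Rightarrow> real) \<Rightarrow> ('a \<Rightarrow> real)) \<Rightarrow> bool" where
  "generator M \<F> \<E> D L Q \<longleftrightarrow>
     self_adjoint M D L \<and> (\<forall>u\<in>D. ip M (L u) u \<le> 0) \<and>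
     spectral_resolution M D (\<lambda>u x. - L u x) Q \<and>
     \<F> = spectral_domain M Q sqrt \<and>
     (\<forall>u\<in>\<F>. \<forall>v\<in>\<F>. \<E> u v = ip M (spectral_op M Q sqrt u) (spectral_op M Q sqrt v))"

definition heat ::
  "'a measure \<Rightarrow> (real set \<Rightarrow> ('a \<Rightarrow> real) \<Rightarrow> ('a \<Rightarrow> real)) \<Rightarrow> real \<Rightarrow>
     ('a \<Rightarrow> real) \<Rightarrow> ('a \<Rightarrow> real)" where
  "heat M Q t = spectral_op M Q (\<lambda>l. exp (- (t * l)))"

definition frac_power ::
  "'a measure \<Rightarrow> (real set \<Rightarrow> ('a \<Rightarrow> real) \<Rightarrow> ('a \<Rightarrow> real)) \<Rightarrow> real \<Rightarrow>
     ('a \<Rightarrow> real) \<Rightarrow> ('a \<Rightarrow> real)" where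
  "frac_power M Q s = spectral_op M Q (\<lambda>l. l powr s)"

definition frac_domain ::
  "'a measure \<Rightarrow> ('a \<Rightarrow> real) set \<Rightarrow> (real set \<Rightarrow> ('a \<Rightarrow> real) \<Rightarrow> ('a \<Rightarrow> real)) \<Rightarrow> real \<Rightarrow>
     ('a \<Rightarrow> real) set" where
  "frac_domain M \<F> Q s =
     {u \<in> \<F>. (\<integral>\<^sup>+ l. ennreal (l powr (2 * s)) \<partial>spectral_measure M Q u) < \<infinity>}"

text \<open>
  Orthogonality to the kernel of the generator. Since \<open>0\<^sup>s = 0\<close>, the function built from
  \<open>(-L)\<^sup>s f\<close> does not see the component of \<open>f\<close> in the kernel, and its weak boundary value is the
  orthogonal projection of \<open>f\<close> off the kernel.
\<close>

definition orthogonal_to_kernel ::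
  "'a measure \<Rightarrow> ('a \<Rightarrow> real) set \<Rightarrow> (('a \<Rightarrow> real) \<Rightarrow> ('a \<Rightarrow> real)) \<Rightarrow> ('a \<Rightarrow> real) \<Rightarrow> bool" where
  "orthogonal_to_kernel M D L f \<longleftrightarrow>
     (\<forall>h\<in>D. (AE x in M. L h x = 0) \<longrightarrow> ip M f h = 0)"


section \<open>The extension problem\<close>

definition bessel_op :: "real \<Rightarrow> (real \<Rightarrow> real) \<Rightarrow> real \<Rightarrow> real" where
  "bessel_op a h y = deriv (deriv h) y + a / y * deriv h y"

text \<open>\<open>(L + B\<^sub>a) U = 0\<close> on \<open>X \<times> (0,\<infinity>)\<close>, after pairing with any \<open>g\<close> in \<open>L\<^sup>2\<close>.\<close>

definition weak_equation ::
  "'a measure \<Rightarrow> ('a \<Rightarrow> real) set \<Rightarrow> (('a \<Rightarrow> real) \<Rightarrow> ('a \<Rightarrow> real)) \<Rightarrow> real \<Rightarrow>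
     (real \<Rightarrow> 'a \<Rightarrow> real) \<Rightarrow> bool" where
  "weak_equation M D L a U \<longleftrightarrow>
     (\<forall>y>0. U y \<in> D \<and>
       (\<forall>g\<in>L2 M.
          (\<lambda>y. ip M (U y) g) field_differentiable at y \<and>
          deriv (\<lambda>y. ip M (U y) g) field_differentiable at y \<and>
          ip M (L (U y)) g + bessel_op a (\<lambda>y. ip M (U y) g) y = 0))"

definition weak_boundary_value ::
  "'a measure \<Rightarrow> ('a \<Rightarrow> real) \<Rightarrow> (real \<Rightarrow> 'a \<Rightarrow> real) \<Rightarrow> bool" where
  "weak_boundary_value M f U \<longleftrightarrow>
     (\<forall>g\<in>L2 M. ((\<lambda>y. ip M (U y) g) \<longlongrightarrow> ip M f g) (at_right 0))"

definition weak_solution ::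
  "'a measure \<Rightarrow> ('a \<Rightarrow> real) set \<Rightarrow> (('a \<Rightarrow> real) \<Rightarrow> ('a \<Rightarrow> real)) \<Rightarrow> real \<Rightarrow>
     ('a \<Rightarrow> real) \<Rightarrow> (real \<Rightarrow> 'a \<Rightarrow> real) \<Rightarrow> bool" where
  "weak_solution M D L a f U \<longleftrightarrow> weak_equation M D L a U \<and> weak_boundary_value M f U"

text \<open>
  \<open>w = c \<integral>\<^sub>0\<^sup>\<infinity> v(t) k(t) dt\<close> weakly, for \<open>L\<^sup>2\<close>-valued \<open>v\<close> and scalar \<open>k\<close>; the scalar integrals are
  required to converge absolutely, since a divergent one has the value 0 in the library.
\<close>

definition has_weak_integral ::
  "'a measure \<Rightarrow> real \<Rightarrow> (real \<Rightarrow> 'a \<Rightarrow> real) \<Rightarrow> (real \<Rightarrow> real) \<Rightarrow> ('a \<Rightarrow> real) \<Rightarrow> bool" where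
  "has_weak_integral M c v k w \<longleftrightarrow>
     w \<in> L2 M \<and>
     (\<forall>g\<in>L2 M.
        set_integrable lborel {0<..} (\<lambda>t. ip M (v t) g * k t) \<and>
        ip M w g = c * (LINT t:{0<..}|lborel. ip M (v t) g * k t))"

text \<open>
  The function \<open>U(\<cdot>,y)\<close>, as a representative of the element of \<open>L\<^sup>2\<close> given by the weak integral;
  its existence has to be proved.
\<close>

definition extension ::
  "'a measure \<Rightarrow> (real set \<Rightarrow> ('a \<Rightarrow> real) \<Rightarrow> ('a \<Rightarrow> real)) \<Rightarrow> real \<Rightarrow> ('a \<Rightarrow> real) \<Rightarrow>
     real \<Rightarrow> 'a \<Rightarrow> real" where
  "extension M Q s f y =
     (SOME w. has_weak_integral M (1 / Gamma s)
        (\<lambda>t. heat M Q t (frac_power M Q s f))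
        (\<lambda>t. exp (- y\<^sup>2 / (4 * t)) / t powr (1 - s)) w)"

end

theory Submission
  imports Defs
begin

text \<open>
  Everything is transported to the spectral side, where it becomes calculus in one real variable.
  Let \<open>m\<close> be the spectral measure of \<open>f\<close>. For each \<open>g\<close> the signed measure \<open>B \<mapsto> \<langle>Q B f, g\<rangle>\<close> has a density
  \<open>h\<close> in \<open>L\<^sup>2(m)\<close>, and every \<open>\<phi>\<close> in \<open>L\<^sup>2(m)\<close> gives an element \<open>\<phi>(-L) f\<close> of \<open>L\<^sup>2\<close> with
  \<open>\<langle>\<phi>(-L) f, g\<rangle> = \<integral> \<phi> h dm\<close> (\<open>pairing_has_L2_density\<close>, \<open>ex_represents\<close>). The existence of this element
  is the completeness of \<open>L\<^sup>2\<close> (\<open>Riesz_Fischer_L2\<close>); applying a second function \<open>\<psi>\<close> of the operator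
  multiplies \<open>\<phi>\<close> by \<open>\<psi>\<close> (\<open>spectral_op_represents\<close>).

  Under this correspondence the heat semigroup is multiplication by \<open>exp (- t \<lambda>)\<close>, and by Fubini's
  theorem a weak integral of it over \<open>t\<close> corresponds to the function of \<open>\<lambda>\<close> obtained by integrating
  pointwise (\<open>has_weak_integral_heat\<close>). For the extension this function is \<open>K\<^sub>s(y\<^sup>2 \<lambda>) / \<Gamma>(s)\<close> on
  \<open>\<lambda> > 0\<close> and \<open>0\<close> at \<open>\<lambda> = 0\<close>, where \<open>K\<^sub>p(z) = \<integral>\<^sub>0\<^sup>\<infinity> exp (- t - z/(4t)) t\<^sup>p\<^sup>-\<^sup>1 dt\<close>.

  Three properties of \<open>K\<^sub>p\<close> then carry the theorem. Differentiation lowers the index,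
  \<open>K\<^sub>p' = - K\<^sub>p\<^sub>-\<^sub>1 / 4\<close>; the substitution \<open>t \<mapsto> z/(4t)\<close> gives \<open>K\<^sub>p(z) = (z/4)\<^sup>p K\<^sub>-\<^sub>p(z)\<close>
  (\<open>bessel_K_reflection\<close>); and differentiating the reflection formula gives the recurrence
  \<open>K\<^sub>p\<^sub>+\<^sub>1 = p K\<^sub>p + (z/4) K\<^sub>p\<^sub>-\<^sub>1\<close>. The recurrence is the differential equation in \<open>y\<close> for each fixed \<open>\<lambda>\<close>.
  The reflection formula converts the defining integral of the extension into the Poisson integral,
  and it turns the weighted derivative into a multiple of \<open>\<lambda>\<^sup>s K\<^sub>1\<^sub>-\<^sub>s(y\<^sup>2 \<lambda>)\<close>, which tends to
  \<open>\<lambda>\<^sup>s \<Gamma>(1 - s)\<close>. The bounds \<open>z\<^sup>n K\<^sub>p(z) \<le> n! 4\<^sup>n \<Gamma>(p + n)\<close> supply the majorants that allow all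
  limits and derivatives to be taken under the integral over \<open>\<lambda>\<close>.

  The profile vanishes at \<open>\<lambda> = 0\<close> while the boundary value and the Poisson integral do see that point.
  This is where orthogonality to the kernel enters: it says exactly that \<open>m\<close> has no atom at \<open>0\<close>
  (\<open>AE_spec_pos\<close>).
\<close>

section \<open>The space of square integrable functions\<close>

lemma L2_integrable_mult:
  assumes "u \<in> L2 M" "v \<in> L2 M"
  shows "integrable M (\<lambda>x. u x * v x)"
proof (rule Bochner_Integration.integrable_bound)
  show "integrable M (\<lambda>x. (u x)\<^sup>2 + (v x)\<^sup>2)"
    using assms by (simp add: L2_def)
  show "(\<lambda>x. u x * v x) \<in> borel_measurable M"
    using assms by (auto simp: L2_def)
  have "\<bar>a * b\<bar> \<le> a\<^sup>2 + b\<^sup>2" for a b :: real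
  proof -
    have "0 \<le> (\<bar>a\<bar> - \<bar>b\<bar>)\<^sup>2" by simp
    then have "2 * \<bar>a * b\<bar> \<le> a\<^sup>2 + b\<^sup>2"
      by (simp add: power2_diff abs_mult)
    then show ?thesis by linarith
  qed
  then show "AE x in M. norm (u x * v x) \<le> norm ((u x)\<^sup>2 + (v x)\<^sup>2)"
    by simp
qed

lemma L2_lincomb:
  assumes "u \<in> L2 M" "v \<in> L2 M"
  shows "(\<lambda>x. b * u x + c * v x) \<in> L2 M"
proof -
  have "integrable M (\<lambda>x. b\<^sup>2 * (u x)\<^sup>2 + (2 * b * c) * (u x * v x) + c\<^sup>2 * (v x)\<^sup>2)"
    using L2_integrable_mult[OF assms] assms by (auto simp: L2_def)
  moreover have "(\<lambda>x. b\<^sup>2 * (u x)\<^sup>2 + (2 * b * c) * (u x * v x) + c\<^sup>2 * (v x)\<^sup>2)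
      = (\<lambda>x. (b * u x + c * v x)\<^sup>2)"
    by (auto simp: power2_eq_square algebra_simps)
  ultimately show ?thesis using assms by (auto simp: L2_def)
qed

lemma L2_zero: "(\<lambda>x. 0) \<in> L2 M"
  by (simp add: L2_def)

lemma L2_cmult: "u \<in> L2 M \<Longrightarrow> (\<lambda>x. c * u x) \<in> L2 M"
  using L2_lincomb[of u M u c 0] by simp

lemma L2_add: "u \<in> L2 M \<Longrightarrow> v \<in> L2 M \<Longrightarrow> (\<lambda>x. u x + v x) \<in> L2 M"
  using L2_lincomb[of u M v 1 1] by simp

lemma L2_diff: "u \<in> L2 M \<Longrightarrow> v \<in> L2 M \<Longrightarrow> (\<lambda>x. u x - v x) \<in> L2 M"
  using L2_lincomb[of u M v 1 "-1"] by simp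

lemma ip_commute: "ip M u v = ip M v u"
  by (simp add: ip_def mult.commute)

lemma ip_self_nonneg: "0 \<le> ip M u u"
  by (simp add: ip_def)

lemma ip_lincomb_left:
  assumes "u \<in> L2 M" "v \<in> L2 M" "g \<in> L2 M"
  shows "ip M (\<lambda>x. b * u x + c * v x) g = b * ip M u g + c * ip M v g"
proof -
  have "ip M (\<lambda>x. b * u x + c * v x) g = (LINT x|M. b * (u x * g x) + c * (v x * g x))"
    by (simp add: ip_def algebra_simps)
  also have "\<dots> = b * ip M u g + c * ip M v g"
    using L2_integrable_mult[OF assms(1,3)] L2_integrable_mult[OF assms(2,3)] by (simp add: ip_def)
  finally show ?thesis .
qed

lemma ip_cmult_left:
  assumes "u \<in> L2 M" "g \<in> L2 M"
  shows "ip M (\<lambda>x. c * u x) g = c * ip M u g"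
  using ip_lincomb_left[OF assms(1) assms(1) assms(2), of c 0] by simp

lemma ip_add_left:
  assumes "u \<in> L2 M" "v \<in> L2 M" "g \<in> L2 M"
  shows "ip M (\<lambda>x. u x + v x) g = ip M u g + ip M v g"
  using ip_lincomb_left[OF assms, of 1 1] by simp

lemma ip_diff_left:
  assumes "u \<in> L2 M" "v \<in> L2 M" "g \<in> L2 M"
  shows "ip M (\<lambda>x. u x - v x) g = ip M u g - ip M v g"
  using ip_lincomb_left[OF assms, of 1 "-1"] by simp

lemma ip_diff_self:
  assumes "u \<in> L2 M" "v \<in> L2 M"
  shows "ip M (\<lambda>x. u x - v x) (\<lambda>x. u x - v x) = ip M u u - 2 * ip M u v + ip M v v"
  using ip_diff_left[OF assms L2_diff[OF assms]] ip_diff_left[OF assms, of u]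
    ip_diff_left[OF assms, of v] assms
  by (simp add: ip_commute)

lemma ip_cong_AE:
  assumes "u \<in> L2 M" "u' \<in> L2 M" "g \<in> L2 M" "AE x in M. u x = u' x"
  shows "ip M u g = ip M u' g"
  unfolding ip_def
  by (rule integral_cong_AE) (use assms in \<open>auto simp: L2_def\<close>)

lemma ip_Cauchy_Schwarz:
  assumes "u \<in> L2 M" "v \<in> L2 M"
  shows "(ip M u v)\<^sup>2 \<le> ip M u u * ip M v v"
proof -
  have q: "2 * c * ip M u v \<le> ip M u u + c\<^sup>2 * ip M v v" for c
  proof -
    have e: "ip M w (\<lambda>x. c * v x) = c * ip M w v" if "w \<in> L2 M" for w
      using ip_cmult_left[OF assms(2) that, of c] by (simp add: ip_commute)
    have "0 \<le> ip M (\<lambda>x. u x - c * v x) (\<lambda>x. u x - c * v x)"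
      by (rule ip_self_nonneg)
    also have "\<dots> = ip M u u - 2 * (c * ip M u v) + c * (c * ip M v v)"
      using ip_diff_self[OF assms(1) L2_cmult[OF assms(2), of c]] assms
      by (simp add: e ip_cmult_left L2_cmult)
    finally show ?thesis by (simp add: power2_eq_square algebra_simps)
  qed
  show ?thesis
  proof (cases "ip M v v = 0")
    case True
    have "ip M u v = 0"
    proof (rule ccontr)
      assume n: "ip M u v \<noteq> 0"
      \<comment> \<open>The right-hand side of \<open>q\<close> no longer depends on \<open>c\<close>, so a large \<open>c\<close> violates it.\<close>
      show False using q[of "(ip M u u + 1) / (2 * ip M u v)"] True n by simp
    qed
    then show ?thesis by (simp add: True)
  next
    case False
    then have p: "0 < ip M v v" using ip_self_nonneg[of M v] by simp
    \<comment> \<open>The value of \<open>c\<close> that minimises the difference of the two sides.\<close>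
    have "(ip M u v)\<^sup>2 / ip M v v \<le> ip M u u"
      using q[of "ip M u v / ip M v v"] p by (simp add: power2_eq_square)
    then show ?thesis using p by (simp add: pos_divide_le_eq)
  qed
qed

lemma ip_self_eq_0_AE:
  assumes "u \<in> L2 M" "ip M u u = 0"
  shows "AE x in M. u x = 0"
proof -
  have "AE x in M. (u x)\<^sup>2 = 0"
    using assms integral_nonneg_eq_0_iff_AE[of M "\<lambda>x. (u x)\<^sup>2"]
    by (simp add: L2_def ip_def power2_eq_square)
  then show ?thesis by simp
qed

text \<open>
  The weight turns square summability into absolute summability, since
  \<open>2 \<bar>a n\<bar> \<le> 2\<^sup>-\<^sup>n + 2\<^sup>n (a n)\<^sup>2\<close>.
\<close>

lemma summable_if_weighted_square_summable:
  fixes a :: "nat \<Rightarrow> real"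
  assumes "summable (\<lambda>n. 2 ^ n * (a n)\<^sup>2)"
  shows "summable a"
proof -
  have "summable (\<lambda>n. (1 / 2) ^ n + 2 ^ n * (a n)\<^sup>2)"
    by (rule summable_add[OF summable_geometric assms]) simp
  moreover have "norm (a n) \<le> (1 / 2) ^ n + 2 ^ n * (a n)\<^sup>2" for n
  proof -
    have "0 \<le> (1 - 2 ^ n * \<bar>a n\<bar>)\<^sup>2 / 2 ^ n" by simp
    also have "\<dots> = (1 / 2) ^ n - 2 * \<bar>a n\<bar> + 2 ^ n * (a n)\<^sup>2"
      by (simp add: power2_diff power_mult_distrib field_simps power2_eq_square)
    finally show ?thesis by (simp del: zero_le_divide_iff)
  qed
  ultimately show ?thesis
    by (rule summable_comparison_test'[where N = 0])
qed

text \<open>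
  A subsequence whose consecutive differences have squared norms at most \<open>4\<^sup>-\<^sup>k\<close> satisfies
  \<open>\<Sum>\<^sub>k 2\<^sup>k \<integral> (b k)\<^sup>2 < \<infinity>\<close> for these differences \<open>b k\<close>. Hence the weighted sum of their squares is
  finite almost everywhere and the subsequence converges pointwise almost everywhere. Fatou's lemma
  shows that the pointwise limit is the limit in \<open>L\<^sup>2\<close> of the whole sequence.
\<close>

theorem Riesz_Fischer_L2:
  fixes w :: "nat \<Rightarrow> 'a \<Rightarrow> real"
  assumes L2: "\<And>n. w n \<in> L2 M"
    and Cauchy: "\<And>\<epsilon>. 0 < \<epsilon> \<Longrightarrow>
      \<exists>N. \<forall>m\<ge>N. \<forall>n\<ge>N. ip M (\<lambda>x. w m x - w n x) (\<lambda>x. w m x - w n x) < \<epsilon>"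
  obtains v where "v \<in> L2 M"
    and "(\<lambda>n. ip M (\<lambda>x. w n x - v x) (\<lambda>x. w n x - v x)) \<longlonglongrightarrow> 0"
proof -
  define d where "d m n = ip M (\<lambda>x. w m x - w n x) (\<lambda>x. w m x - w n x)" for m n
  have meas [measurable]: "w n \<in> borel_measurable M" for n using L2 by (auto simp: L2_def)
  have d_nn: "ennreal (d m n) = (\<integral>\<^sup>+x. ennreal ((w m x - w n x)\<^sup>2) \<partial>M)" for m n
    unfolding d_def ip_def
    using L2_integrable_mult[OF L2_diff[OF L2[of m] L2[of n]] L2_diff[OF L2[of m] L2[of n]]]
    by (subst nn_integral_eq_integral[symmetric]) (auto simp: power2_eq_square)
  have "\<forall>k. \<exists>N. \<forall>m\<ge>N. \<forall>n\<ge>N. d m n < (1 / 4) ^ k"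
    using Cauchy unfolding d_def by simp
  then obtain N where N: "\<And>k m n. m \<ge> N k \<Longrightarrow> n \<ge> N k \<Longrightarrow> d m n < (1 / 4) ^ k"
    by metis
  \<comment> \<open>Partial sums make the subsequence of indices monotone while keeping \<open>r k \<ge> N k\<close>.\<close>
  define r where "r k = (\<Sum>i\<le>k. N i)" for k
  have rN: "N k \<le> r k" for k unfolding r_def by (rule member_le_sum) auto
  have rmono: "r k \<le> r l" if "k \<le> l" for k l
    unfolding r_def using that by (intro sum_mono2) auto
  define b where "b k x = w (r (Suc k)) x - w (r k) x" for k x
  have b: "(\<integral>\<^sup>+x. ennreal ((b k x)\<^sup>2) \<partial>M) \<le> ennreal ((1 / 4) ^ k)" for k
  proof -
    have "d (r (Suc k)) (r k) < (1 / 4) ^ k"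
      using rN[of k] rmono[of k "Suc k"] by (intro N) auto
    then show ?thesis unfolding b_def d_nn[symmetric] by (intro ennreal_leI) auto
  qed
  have [measurable]: "b k \<in> borel_measurable M" for k unfolding b_def by measurable
  have "(\<integral>\<^sup>+x. (\<Sum>k. ennreal (2 ^ k * (b k x)\<^sup>2)) \<partial>M)
      = (\<Sum>k. \<integral>\<^sup>+x. ennreal (2 ^ k * (b k x)\<^sup>2) \<partial>M)"
    by (rule nn_integral_suminf) measurable
  also have "\<dots> \<le> (\<Sum>k. ennreal ((1 / 2) ^ k))"
  proof (rule suminf_le)
    fix k
    have "(\<integral>\<^sup>+x. ennreal (2 ^ k * (b k x)\<^sup>2) \<partial>M) = ennreal (2 ^ k) * (\<integral>\<^sup>+x. ennreal ((b k x)\<^sup>2) \<partial>M)"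
      by (subst nn_integral_cmult[symmetric]) (auto simp: ennreal_mult)
    also have "\<dots> \<le> ennreal (2 ^ k) * ennreal ((1 / 4) ^ k)"
      by (intro mult_left_mono b) auto
    also have "\<dots> = ennreal ((1 / 2) ^ k)"
      by (subst ennreal_mult[symmetric]) (auto simp: power_mult_distrib[symmetric])
    finally show "(\<integral>\<^sup>+x. ennreal (2 ^ k * (b k x)\<^sup>2) \<partial>M) \<le> ennreal ((1 / 2) ^ k)" .
  qed auto
  also have "\<dots> < \<infinity>"
  proof -
    have "(\<Sum>k. ennreal ((1 / 2 :: real) ^ k)) = ennreal (\<Sum>k. (1 / 2) ^ k)"
      by (rule suminf_ennreal2[OF _ summable_geometric]) simp_all
    then show ?thesis by simp
  qed
  finally have "AE x in M. (\<Sum>k. ennreal (2 ^ k * (b k x)\<^sup>2)) \<noteq> \<infinity>"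
    by (intro nn_integral_PInf_AE) auto
  then have conv: "AE x in M. convergent (\<lambda>k. w (r k) x)"
  proof eventually_elim
    case (elim x)
    have "summable (\<lambda>k. 2 ^ k * (b k x)\<^sup>2)"
      by (rule summable_suminf_not_top) (use elim in auto)
    then have "summable (\<lambda>k. b k x)" by (rule summable_if_weighted_square_summable)
    then have "convergent (\<lambda>n. \<Sum>k<n. b k x)" by (simp add: summable_iff_convergent)
    moreover have "(\<Sum>k<n. b k x) = w (r n) x - w (r 0) x" for n
      unfolding b_def by (rule sum_lessThan_telescope)
    ultimately have "convergent (\<lambda>n. (w (r n) x - w (r 0) x) + w (r 0) x)"
      by (intro convergent_add convergent_const) simp
    then show ?case by simp
  qed
  define v where "v x = lim (\<lambda>k. w (r k) x)" for x
  have [measurable]: "v \<in> borel_measurable M" unfolding v_def by measurable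
  have lim: "AE x in M. (\<lambda>k. w (r k) x) \<longlonglongrightarrow> v x"
    using conv by eventually_elim (simp add: v_def convergent_LIMSEQ_iff)
  have close: "(\<integral>\<^sup>+x. ennreal ((w n x - v x)\<^sup>2) \<partial>M) \<le> ennreal ((1 / 4) ^ k)" if "n \<ge> N k" for n k
  proof -
    have "(\<integral>\<^sup>+x. ennreal ((w n x - v x)\<^sup>2) \<partial>M)
        = (\<integral>\<^sup>+x. liminf (\<lambda>j. ennreal ((w n x - w (r j) x)\<^sup>2)) \<partial>M)"
    proof (rule nn_integral_cong_AE, use lim in eventually_elim)
      case (elim x)
      have "(\<lambda>j. ennreal ((w n x - w (r j) x)\<^sup>2)) \<longlonglongrightarrow> ennreal ((w n x - v x)\<^sup>2)"
        by (intro tendsto_intros elim)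
      then show ?case by (rule lim_imp_Liminf[OF sequentially_bot, symmetric])
    qed
    also have "\<dots> \<le> liminf (\<lambda>j. \<integral>\<^sup>+x. ennreal ((w n x - w (r j) x)\<^sup>2) \<partial>M)"
      by (rule nn_integral_liminf) measurable
    also have "\<dots> \<le> ennreal ((1 / 4) ^ k)"
    proof (rule Liminf_le[OF sequentially_bot])
      show "\<forall>\<^sub>F j in sequentially. (\<integral>\<^sup>+x. ennreal ((w n x - w (r j) x)\<^sup>2) \<partial>M) \<le> ennreal ((1 / 4) ^ k)"
        using eventually_ge_at_top[of k]
      proof eventually_elim
        case (elim j)
        have "d n (r j) < (1 / 4) ^ k" using that rN[of k] rmono[OF elim] by (intro N) auto
        then show ?case unfolding d_nn[symmetric] by (intro ennreal_leI) auto
      qed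
    qed
    finally show ?thesis .
  qed
  have diff_L2: "(\<lambda>x. w n x - v x) \<in> L2 M" if "n \<ge> N k" for n k
  proof -
    have "integrable M (\<lambda>x. (w n x - v x)\<^sup>2)"
      by (rule integrableI_bounded) (use close[OF that] in \<open>auto simp: order_le_less_trans\<close>)
    then show ?thesis by (simp add: L2_def)
  qed
  have v_L2: "v \<in> L2 M"
    using L2_diff[OF L2[of "N 0"] diff_L2[of 0 "N 0"]] by simp
  have "(\<lambda>n. ip M (\<lambda>x. w n x - v x) (\<lambda>x. w n x - v x)) \<longlonglongrightarrow> 0"
  proof (rule LIMSEQ_I)
    fix e :: real assume "0 < e"
    then obtain k where k: "(1 / 4) ^ k < e"
      using real_arch_pow_inv[of e "1 / 4"] by auto
    have "norm (ip M (\<lambda>x. w n x - v x) (\<lambda>x. w n x - v x) - 0) < e" if "n \<ge> N k" for n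
    proof -
      have i: "integrable M (\<lambda>x. (w n x - v x)\<^sup>2)" using diff_L2[OF that] by (simp add: L2_def)
      have "ennreal (ip M (\<lambda>x. w n x - v x) (\<lambda>x. w n x - v x)) \<le> ennreal ((1 / 4) ^ k)"
        using close[OF that] nn_integral_eq_integral[OF i]
        by (simp add: ip_def power2_eq_square)
      then show ?thesis using k by (simp add: ip_self_nonneg ennreal_le_iff)
    qed
    then show "\<exists>no. \<forall>n\<ge>no. norm (ip M (\<lambda>x. w n x - v x) (\<lambda>x. w n x - v x) - 0) < e" by blast
  qed
  with v_L2 show thesis by (rule that)
qed

lemma ip_tendsto:
  fixes w :: "nat \<Rightarrow> 'a \<Rightarrow> real"
  assumes L2: "\<And>n. w n \<in> L2 M" "v \<in> L2 M" "g \<in> L2 M"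
    and lim: "(\<lambda>n. ip M (\<lambda>x. w n x - v x) (\<lambda>x. w n x - v x)) \<longlonglongrightarrow> 0"
  shows "(\<lambda>n. ip M (w n) g) \<longlonglongrightarrow> ip M v g"
proof -
  have "(\<lambda>n. sqrt (ip M (\<lambda>x. w n x - v x) (\<lambda>x. w n x - v x) * ip M g g)) \<longlonglongrightarrow> sqrt (0 * ip M g g)"
    by (intro tendsto_intros lim)
  then have z: "(\<lambda>n. sqrt (ip M (\<lambda>x. w n x - v x) (\<lambda>x. w n x - v x) * ip M g g)) \<longlonglongrightarrow> 0" by simp
  have "\<bar>ip M (w n) g - ip M v g\<bar> \<le> sqrt (ip M (\<lambda>x. w n x - v x) (\<lambda>x. w n x - v x) * ip M g g)" for n
    using ip_Cauchy_Schwarz[OF L2_diff[OF L2(1)[of n] L2(2)] L2(3)] L2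
    by (intro real_le_rsqrt) (simp add: ip_diff_left)
  then have "(\<lambda>n. ip M (w n) g - ip M v g) \<longlonglongrightarrow> 0"
    by (intro Lim_null_comparison[OF _ z]) simp
  then show ?thesis by (simp add: LIM_zero_iff)
qed

section \<open>Integration against a signed measure with a density\<close>

lemma integral_indicator_le_nn_integral:
  fixes k :: "'a \<Rightarrow> real"
  assumes [measurable]: "integrable m k" and [measurable]: "C \<in> sets m"
  shows "ennreal (LINT x|m. indicator C x * k x) \<le> (\<integral>\<^sup>+x. ennreal (k x) * indicator C x \<partial>m)"
proof -
  have i: "integrable m (\<lambda>x. indicator C x * max 0 (k x))"
    using integrable_mult_indicator[of C m "\<lambda>x. max 0 (k x)"] assms by simp
  have j: "integrable m (\<lambda>x. indicator C x * k x)"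
    using integrable_mult_indicator[of C m k] assms by simp
  have "(LINT x|m. indicator C x * k x) \<le> (LINT x|m. indicator C x * max 0 (k x))"
    by (rule integral_mono[OF j i]) (auto simp: indicator_def)
  then have "ennreal (LINT x|m. indicator C x * k x) \<le> ennreal (LINT x|m. indicator C x * max 0 (k x))"
    by (rule ennreal_leI)
  also have "\<dots> = (\<integral>\<^sup>+x. ennreal (indicator C x * max 0 (k x)) \<partial>m)"
    by (rule nn_integral_eq_integral[OF i, symmetric]) (auto simp: indicator_def)
  also have "\<dots> = (\<integral>\<^sup>+x. ennreal (k x) * indicator C x \<partial>m)"
    by (rule nn_integral_cong) (auto simp: indicator_def max_def ennreal_neg)
  finally show ?thesis .
qed

text \<open>
  For the signed measure with density \<open>k\<close> the positive variation has density \<open>k\<^sup>+\<close>. The function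
  \<^const>\<open>ennreal\<close> sends negative numbers to 0, so \<open>ennreal (k x)\<close> already is the positive part.
\<close>

lemma positive_variation_density:
  fixes k :: "real \<Rightarrow> real"
  assumes sets: "sets m = sets borel" and k [measurable]: "integrable m k"
    and \<nu>: "\<And>B. B \<in> sets borel \<Longrightarrow> \<nu> B = (LINT x|m. indicator B x * k x)"
  shows "positive_variation \<nu> = density m (\<lambda>x. ennreal (k x))"
proof -
  have sp: "space m = UNIV" using sets_eq_imp_space_eq[OF sets] by simp
  have "(SUP C\<in>{C \<in> sets borel. C \<subseteq> B}. ennreal (\<nu> C)) = (\<integral>\<^sup>+x. ennreal (k x) * indicator B x \<partial>m)"
    if B: "B \<in> sets borel" for B
  proof (rule antisym)
    show "(SUP C\<in>{C \<in> sets borel. C \<subseteq> B}. ennreal (\<nu> C)) \<le> (\<integral>\<^sup>+x. ennreal (k x) * indicator B x \<partial>m)"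
    proof (rule SUP_least)
      fix C assume C: "C \<in> {C \<in> sets borel. C \<subseteq> B}"
      then have "ennreal (\<nu> C) \<le> (\<integral>\<^sup>+x. ennreal (k x) * indicator C x \<partial>m)"
        using integral_indicator_le_nn_integral[OF k, of C] \<nu>[of C] by (simp add: sets)
      also have "\<dots> \<le> (\<integral>\<^sup>+x. ennreal (k x) * indicator B x \<partial>m)"
        using C by (intro nn_integral_mono) (auto simp: indicator_def)
      finally show "ennreal (\<nu> C) \<le> (\<integral>\<^sup>+x. ennreal (k x) * indicator B x \<partial>m)" .
    qed
    \<comment> \<open>The supremum is attained on the part of \<open>B\<close> where the density is positive.\<close>
    define C where "C = B \<inter> {x \<in> space m. 0 < k x}"
    have Cm: "C \<in> sets m" unfolding C_def using B by (auto simp: sets[symmetric])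
    then have C: "C \<in> sets borel" "C \<subseteq> B" by (auto simp: C_def sets)
    have i: "integrable m (\<lambda>x. indicator C x * k x)"
      using integrable_mult_indicator[OF Cm k] by simp
    have "(\<integral>\<^sup>+x. ennreal (k x) * indicator B x \<partial>m) = (\<integral>\<^sup>+x. ennreal (indicator C x * k x) \<partial>m)"
      by (rule nn_integral_cong) (auto simp: indicator_def C_def sp ennreal_neg)
    also have "\<dots> = ennreal (\<nu> C)"
      unfolding \<nu>[OF C(1)] by (rule nn_integral_eq_integral[OF i]) (auto simp: indicator_def C_def)
    also have "\<dots> \<le> (SUP C\<in>{C \<in> sets borel. C \<subseteq> B}. ennreal (\<nu> C))"
      using C by (intro SUP_upper) auto
    finally show "(\<integral>\<^sup>+x. ennreal (k x) * indicator B x \<partial>m) \<le> (SUP C\<in>{C \<in> sets borel. C \<subseteq> B}. ennreal (\<nu> C))" .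
  qed
  then show ?thesis
    unfolding positive_variation_def density_def sets sp
    by (intro measure_of_eq) (auto simp: sets.sigma_sets_eq[of borel, simplified])
qed

lemma signed_integral_density:
  fixes k \<phi> :: "real \<Rightarrow> real"
  assumes sets: "sets m = sets borel" and k [measurable]: "integrable m k"
    and \<nu>: "\<And>B. B \<in> sets borel \<Longrightarrow> \<nu> B = (LINT x|m. indicator B x * k x)"
    and \<phi>: "\<phi> \<in> borel_measurable borel" and i: "integrable m (\<lambda>x. \<phi> x * k x)"
  shows "signed_integral \<nu> \<phi> = (LINT x|m. \<phi> x * k x)"
proof -
  have [measurable]: "\<phi> \<in> borel_measurable m" using \<phi> measurable_cong_sets[OF sets refl] by blast
  have part: "(LINT l|density m (\<lambda>x. ennreal (h x)). \<phi> l) = (LINT x|m. max 0 (h x) * \<phi> x)"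
    if h [measurable]: "h \<in> borel_measurable m" for h
  proof -
    have "density m (\<lambda>x. ennreal (h x)) = density m (\<lambda>x. ennreal (max 0 (h x)))"
      by (rule arg_cong[where f = "density m"]) (auto simp: max_def ennreal_neg)
    moreover have "(LINT l|density m (\<lambda>x. ennreal (max 0 (h x))). \<phi> l) = (LINT x|m. max 0 (h x) *\<^sub>R \<phi> x)"
      by (rule integral_density) auto
    ultimately show ?thesis by simp
  qed
  have ij: "integrable m (\<lambda>x. max 0 (c * k x) * \<phi> x)" if "\<bar>c\<bar> = 1" for c
  proof (rule Bochner_Integration.integrable_bound[OF i])
    have "c = 1 \<or> c = -1" using that by linarith
    then show "AE x in m. norm (max 0 (c * k x) * \<phi> x) \<le> norm (\<phi> x * k x)"
      by (auto simp: abs_mult max_def mult.commute)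
  qed simp
  have neg: "- \<nu> B = (LINT x|m. indicator B x * - k x)" if "B \<in> sets borel" for B
    using \<nu>[OF that] by simp
  have "signed_integral \<nu> \<phi> = (LINT x|m. max 0 (1 * k x) * \<phi> x) - (LINT x|m. max 0 (-1 * k x) * \<phi> x)"
    unfolding signed_integral_def
    using positive_variation_density[OF sets k \<nu>]
      positive_variation_density[OF sets integrable_minus[OF k] neg]
    by (simp add: part)
  also have "\<dots> = (LINT x|m. max 0 (1 * k x) * \<phi> x - max 0 (-1 * k x) * \<phi> x)"
    by (rule Bochner_Integration.integral_diff[symmetric]; rule ij) simp_all
  also have "\<dots> = (LINT x|m. \<phi> x * k x)"
    by (rule Bochner_Integration.integral_cong) (auto simp: max_def)
  finally show ?thesis .
qed

section \<open>Projection valued measures and spectral densities\<close>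

locale projection_valued_measure =
  fixes M :: "'a measure" and Q :: "real set \<Rightarrow> ('a \<Rightarrow> real) \<Rightarrow> ('a \<Rightarrow> real)"
  assumes resolution: "resolution_of_identity M Q"
begin

lemma proj_L2 [simp, intro]: "B \<in> sets borel \<Longrightarrow> u \<in> L2 M \<Longrightarrow> Q B u \<in> L2 M"
  using resolution by (auto simp: resolution_of_identity_def linear_L2_def)

lemma proj_sym: "B \<in> sets borel \<Longrightarrow> u \<in> L2 M \<Longrightarrow> v \<in> L2 M \<Longrightarrow> ip M (Q B u) v = ip M u (Q B v)"
  using resolution by (auto simp: resolution_of_identity_def)

lemma ip_proj_proj:
  assumes [simp]: "B \<in> sets borel" "C \<in> sets borel" "u \<in> L2 M" "v \<in> L2 M"
  shows "ip M (Q B u) (Q C v) = ip M (Q (B \<inter> C) u) v"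
proof -
  have "ip M (Q B u) (Q C v) = ip M (Q C (Q B u)) v" by (simp add: proj_sym)
  also have "\<dots> = ip M (Q (C \<inter> B) u) v"
  proof (rule ip_cong_AE)
    have "AE x in M. Q (C \<inter> B) u x = Q C (Q B u) x"
      using resolution assms unfolding resolution_of_identity_def by blast
    then show "AE x in M. Q C (Q B u) x = Q (C \<inter> B) u x" by eventually_elim simp
    show "Q (C \<inter> B) u \<in> L2 M" by (rule proj_L2) auto
  qed auto
  finally show ?thesis by (simp add: Int_commute)
qed

lemma ip_proj_self: "B \<in> sets borel \<Longrightarrow> u \<in> L2 M \<Longrightarrow> ip M (Q B u) (Q B u) = ip M (Q B u) u"
  by (simp add: ip_proj_proj)

lemma ip_proj_nonneg: "B \<in> sets borel \<Longrightarrow> u \<in> L2 M \<Longrightarrow> 0 \<le> ip M (Q B u) u"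
  by (metis ip_proj_self ip_self_nonneg)

lemma ip_proj_sums:
  "range B \<subseteq> sets borel \<Longrightarrow> disjoint_family (B :: nat \<Rightarrow> real set) \<Longrightarrow> u \<in> L2 M \<Longrightarrow> v \<in> L2 M \<Longrightarrow>
    (\<lambda>n. ip M (Q (B n) u) v) sums ip M (Q (\<Union>n. B n) u) v"
  using resolution unfolding resolution_of_identity_def by blast

lemma ip_proj_empty:
  assumes "u \<in> L2 M" "v \<in> L2 M" shows "ip M (Q {} u) v = 0"
proof -
  have "(\<lambda>n::nat. ip M (Q {} u) v) sums ip M (Q (\<Union>n::nat. {}) u) v"
    using assms by (intro ip_proj_sums) (auto simp: disjoint_family_on_def)
  then have "summable (\<lambda>n::nat. ip M (Q {} u) v)" by (rule sums_summable)
  then show ?thesis by (simp add: summable_const_iff)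
qed

lemma ip_proj_Un:
  assumes "B \<in> sets borel" "C \<in> sets borel" "B \<inter> C = {}" "u \<in> L2 M" "v \<in> L2 M"
  shows "ip M (Q (B \<union> C) u) v = ip M (Q B u) v + ip M (Q C u) v"
proof -
  have r: "range (binaryset B C) \<subseteq> sets borel" using assms by (auto simp: range_binaryset_eq)
  have d: "disjoint_family (binaryset B C)"
    using assms(3) by (auto simp: disjoint_family_on_def binaryset_def)
  have "(\<lambda>n. ip M (Q (binaryset B C n) u) v) sums ip M (Q (B \<union> C) u) v"
    using ip_proj_sums[OF r d assms(4,5)] by (simp add: UN_binaryset_eq)
  moreover have "(\<lambda>n. ip M (Q (binaryset B C n) u) v) sums (ip M (Q B u) v + ip M (Q C u) v)"
    using binaryset_sums[of "\<lambda>B. ip M (Q B u) v" B C] assms ip_proj_empty by simp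
  ultimately show ?thesis by (rule sums_unique2)
qed

lemma ip_proj_UNIV:
  assumes u: "u \<in> L2 M" and g: "g \<in> L2 M" shows "ip M (Q UNIV u) g = ip M u g"
proof -
  have r: "AE x in M. Q {0..} v x = v x" if "v \<in> L2 M" for v
    using resolution that unfolding resolution_of_identity_def by blast
  have e: "ip M (Q {0..} v) g = ip M v g" if "v \<in> L2 M" for v
    using that g r by (intro ip_cong_AE) auto
  have "ip M (Q {0..} (Q UNIV u)) g = ip M (Q UNIV u) (Q {0..} g)"
    using u g by (simp add: proj_sym)
  then have "ip M (Q UNIV u) g = ip M (Q {0..} u) g"
    using u g by (simp add: e ip_proj_proj)
  then show ?thesis using e[OF u] by simp
qed

lemma ip_proj_lincomb:
  assumes [simp]: "B \<in> sets borel" "u \<in> L2 M" "v \<in> L2 M" "g \<in> L2 M"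
  shows "ip M (Q B (\<lambda>x. b * u x + c * v x)) g = b * ip M (Q B u) g + c * ip M (Q B v) g"
  using ip_lincomb_left[of u M v "Q B g" b c] by (simp add: proj_sym L2_lincomb)

text \<open>
  For a pairing of constant sign, weak countable additivity of the projections makes the set function
  a genuine measure, so that \<^const>\<open>measure_of\<close> returns it unchanged. The case \<open>w = u\<close> is the spectral
  measure; the general case is needed for the Radon-Nikodym theorem below.
\<close>

lemma emeasure_nonneg_pairing:
  assumes u: "u \<in> L2 M" and w: "w \<in> L2 M"
    and nonneg: "\<And>B. B \<in> sets borel \<Longrightarrow> 0 \<le> ip M (Q B u) w" and B: "B \<in> sets borel"
  shows "emeasure (measure_of UNIV (sets borel) (\<lambda>B. ennreal (ip M (Q B u) w))) B
    = ennreal (ip M (Q B u) w)"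
proof (rule emeasure_measure_of[OF refl])
  have s: "sets (measure_of UNIV (sets borel) (\<lambda>B. ennreal (ip M (Q B u) w))) = sets borel"
    using sets.sets_measure_of_eq[of borel] by simp
  show "B \<in> sets (measure_of UNIV (sets borel) (\<lambda>B. ennreal (ip M (Q B u) w)))"
    using B s by simp
  show "positive (sets (measure_of UNIV (sets borel) (\<lambda>B. ennreal (ip M (Q B u) w))))
      (\<lambda>B. ennreal (ip M (Q B u) w))"
    by (simp add: positive_def ip_proj_empty u w)
  show "countably_additive (sets (measure_of UNIV (sets borel) (\<lambda>B. ennreal (ip M (Q B u) w))))
      (\<lambda>B. ennreal (ip M (Q B u) w))"
    unfolding s countably_additive_def
  proof (intro allI impI)
    fix A :: "nat \<Rightarrow> real set"
    assume A: "range A \<subseteq> sets borel" "disjoint_family A"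
    have "(\<lambda>n. ip M (Q (A n) u) w) sums ip M (Q (\<Union>n. A n) u) w"
      using A u w by (rule ip_proj_sums)
    then show "(\<Sum>n. ennreal (ip M (Q (A n) u) w)) = ennreal (ip M (Q (\<Union>n. A n) u) w)"
      using nonneg A by (intro suminf_ennreal_eq) auto
  qed
qed auto

abbreviation spec :: "('a \<Rightarrow> real) \<Rightarrow> real measure" where
  "spec u \<equiv> spectral_measure M Q u"

lemma sets_spec [measurable_cong, simp]: "sets (spec u) = sets borel"
  using sets.sets_measure_of_eq[of borel] by (simp add: spectral_measure_def)

lemma space_spec [simp]: "space (spec u) = UNIV"
  by (simp add: spectral_measure_def)

lemma emeasure_spec:
  "u \<in> L2 M \<Longrightarrow> B \<in> sets borel \<Longrightarrow> emeasure (spec u) B = ennreal (ip M (Q B u) u)"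
  unfolding spectral_measure_def by (rule emeasure_nonneg_pairing) (auto simp: ip_proj_nonneg)

lemma finite_measure_spec: "u \<in> L2 M \<Longrightarrow> finite_measure (spec u)"
  by (rule finite_measureI) (simp add: emeasure_spec)

lemma measure_spec:
  "u \<in> L2 M \<Longrightarrow> B \<in> sets borel \<Longrightarrow> measure (spec u) B = ip M (Q B u) u"
  by (simp add: measure_def emeasure_spec ip_proj_nonneg)

lemma bounded_L2_spec:
  fixes \<phi> :: "real \<Rightarrow> real"
  assumes u: "u \<in> L2 M" and "\<phi> \<in> borel_measurable borel" and "\<And>x. \<bar>\<phi> x\<bar> \<le> C"
  shows "\<phi> \<in> L2 (spec u)"
proof -
  interpret finite_measure "spec u" by (rule finite_measure_spec[OF u])
  have m [measurable]: "\<phi> \<in> borel_measurable (spec u)"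
    using assms(2) by measurable
  have "(\<phi> x)\<^sup>2 \<le> C\<^sup>2" for x using assms(3)[of x] by (metis abs_ge_zero power2_abs power_mono)
  then have "integrable (spec u) (\<lambda>x. (\<phi> x)\<^sup>2)"
    by (intro integrable_const_bound[where B = "C\<^sup>2"]) auto
  then show ?thesis by (simp add: L2_def m)
qed

lemma indicator_L2_spec: "u \<in> L2 M \<Longrightarrow> B \<in> sets borel \<Longrightarrow> indicator B \<in> L2 (spec u)"
  by (rule bounded_L2_spec[where C = 1]) (auto simp: indicator_def)

lemma pairing_Cauchy_Schwarz:
  assumes [simp]: "u \<in> L2 M" "w \<in> L2 M" "B \<in> sets borel"
  shows "(ip M (Q B u) w)\<^sup>2 \<le> measure (spec u) B * measure (spec w) B"
  using ip_Cauchy_Schwarz[of "Q B u" M "Q B w"] by (simp add: ip_proj_proj measure_spec)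

text \<open>
  By the Cauchy-Schwarz inequality \<open>\<langle>Q B u, w\<rangle>\<^sup>2 \<le> m\<^sub>u(B) m\<^sub>w(B)\<close>, so the pairing is absolutely continuous
  with respect to the spectral measure \<open>m\<^sub>u\<close> and has a Radon-Nikodym density \<open>h\<close>. The same inequality
  on the level sets of \<open>h\<^sup>2\<close> shows that \<open>h\<^sup>2 m\<^sub>u\<close> is dominated by the finite measure \<open>m\<^sub>w\<close>, hence that
  \<open>h\<close> is square integrable.
\<close>

lemma nonneg_pairing_has_L2_density:
  assumes u: "u \<in> L2 M" and w: "w \<in> L2 M"
    and nonneg: "\<And>B. B \<in> sets borel \<Longrightarrow> 0 \<le> ip M (Q B u) w"
  shows "\<exists>h\<in>L2 (spec u). \<forall>B\<in>sets borel. ip M (Q B u) w = ip (spec u) (indicator B) h"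
proof -
  interpret finite_measure "spec u" by (rule finite_measure_spec[OF u])
  interpret W: finite_measure "spec w" by (rule finite_measure_spec[OF w])
  define N where "N = measure_of UNIV (sets borel) (\<lambda>B. ennreal (ip M (Q B u) w))"
  have emN: "emeasure N B = ennreal (ip M (Q B u) w)" if "B \<in> sets borel" for B
    unfolding N_def using u w nonneg that by (rule emeasure_nonneg_pairing)
  have setsN: "sets N = sets (spec u)"
    unfolding N_def using sets.sets_measure_of_eq[of borel] by simp
  have spN: "space N = UNIV" using sets_eq_imp_space_eq[OF setsN] by simp
  have finN: "finite_measure N" by (rule finite_measureI) (simp add: emN spN)
  have ac: "absolutely_continuous (spec u) N"
    unfolding absolutely_continuous_def
  proof
    fix B assume "B \<in> null_sets (spec u)"
    then have B: "B \<in> sets borel" "measure (spec u) B = 0"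
      by (auto simp: null_sets_def measure_def)
    then have "ip M (Q B u) w = 0" using pairing_Cauchy_Schwarz[OF u w B(1)] by simp
    then show "B \<in> null_sets N" using B emN[of B] setsN by (auto simp: null_sets_def)
  qed
  obtain h where h [measurable]: "h \<in> borel_measurable (spec u)"
    and RN: "AE x in spec u. RN_deriv (spec u) N x = ennreal (h x)" and h0: "\<And>x. 0 \<le> h x"
    using real_RN_deriv[OF finN ac setsN] by metis
  have pairing_density: "ennreal (ip M (Q B u) w) = (\<integral>\<^sup>+x. ennreal (h x) * indicator B x \<partial>spec u)"
    if B: "B \<in> sets borel" for B
  proof -
    have "ennreal (ip M (Q B u) w) = emeasure (density (spec u) (RN_deriv (spec u) N)) B"
      by (simp add: density_RN_deriv[OF ac setsN] emN[OF B])
    also have "\<dots> = (\<integral>\<^sup>+x. RN_deriv (spec u) N x * indicator B x \<partial>spec u)"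
      using B by (intro emeasure_density) auto
    also have "\<dots> = (\<integral>\<^sup>+x. ennreal (h x) * indicator B x \<partial>spec u)"
      using RN by (intro nn_integral_cong_AE) auto
    finally show ?thesis .
  qed
  \<comment> \<open>On a set where \<open>h \<ge> a\<close> the Cauchy-Schwarz inequality bounds \<open>a\<^sup>2\<close> by the quotient of the
    two spectral measures.\<close>
  have level: "a\<^sup>2 * measure (spec u) B \<le> measure (spec w) B"
    if B: "B \<in> sets borel" and a: "0 \<le> a" "\<And>x. x \<in> B \<Longrightarrow> a \<le> h x" for a B
  proof -
    let ?p = "measure (spec u) B" and ?q = "measure (spec w) B"
    have "ennreal (a * ?p) = (\<integral>\<^sup>+x. ennreal a * indicator B x \<partial>spec u)"
      using B a by (simp add: nn_integral_cmult_indicator ennreal_mult emeasure_eq_measure)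
    also have "\<dots> \<le> (\<integral>\<^sup>+x. ennreal (h x) * indicator B x \<partial>spec u)"
      using a by (intro nn_integral_mono) (auto simp: indicator_def intro: ennreal_leI)
    finally have "a * ?p \<le> ip M (Q B u) w"
      using nonneg[OF B] by (simp add: pairing_density[OF B, symmetric] ennreal_le_iff)
    then have "(a * ?p)\<^sup>2 \<le> (ip M (Q B u) w)\<^sup>2" using a by (intro power_mono) auto
    also have "\<dots> \<le> ?p * ?q" by (rule pairing_Cauchy_Schwarz[OF u w B])
    finally have "?p * (a\<^sup>2 * ?p) \<le> ?p * ?q" by (simp add: power2_eq_square mult_ac)
    then show ?thesis using measure_nonneg[of "spec u" B] measure_nonneg[of "spec w" B]
      by (cases "?p = 0") (auto simp: mult_le_cancel_left)
  qed
  have "(\<integral>\<^sup>+x. ennreal ((h x)\<^sup>2) \<partial>spec u) \<le> emeasure (spec w) UNIV"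
    unfolding nn_integral_def
  proof (rule SUP_least, safe)
    fix g assume g: "simple_function (spec u) g" and le: "g \<le> (\<lambda>x. ennreal ((h x)\<^sup>2))"
    have gm: "g -` {c} \<in> sets borel" for c
      using simple_functionD(2)[OF g, of "{c}"] by simp
    have "c * emeasure (spec u) (g -` {c}) \<le> emeasure (spec w) (g -` {c})" if "c \<in> range g" for c
    proof -
      from that obtain x0 where "c = g x0" by auto
      then have "c \<le> ennreal ((h x0)\<^sup>2)" using le by (auto simp: le_fun_def)
      then obtain c' where c': "c = ennreal c'" "0 \<le> c'" by (cases c) (auto simp: top_unique)
      have "sqrt c' \<le> h x" if "x \<in> g -` {c}" for x
      proof -
        have "ennreal c' = g x" using that c' by simp
        also have "\<dots> \<le> ennreal ((h x)\<^sup>2)" using le by (simp add: le_fun_def)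
        finally have "ennreal c' \<le> ennreal ((h x)\<^sup>2)" .
        then show ?thesis using h0[of x] by (intro real_le_lsqrt) (auto simp: ennreal_le_iff)
      qed
      from level[OF gm _ this] have "c' * measure (spec u) (g -` {c}) \<le> measure (spec w) (g -` {c})"
        using c'(2) by simp
      then show ?thesis using c'
        by (simp add: emeasure_eq_measure W.emeasure_eq_measure ennreal_mult[symmetric] ennreal_leI)
    qed
    then have "integral\<^sup>S (spec u) g \<le> (\<Sum>c\<in>range g. emeasure (spec w) (g -` {c}))"
      unfolding simple_integral_def by (auto intro!: sum_mono)
    also have "\<dots> = emeasure (spec w) (\<Union>c\<in>range g. g -` {c})"
      using gm simple_functionD(1)[OF g]
      by (intro sum_emeasure) (auto simp: disjoint_family_on_def)
    also have "\<dots> \<le> emeasure (spec w) UNIV"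
      using emeasure_space[of "spec w"] by simp
    finally show "integral\<^sup>S (spec u) g \<le> emeasure (spec w) UNIV" .
  qed
  also have "\<dots> < \<infinity>" by (simp add: emeasure_spec[OF w])
  finally have "integrable (spec u) (\<lambda>x. (h x)\<^sup>2)" by (intro integrableI_bounded) auto
  then have hL2: "h \<in> L2 (spec u)" using h by (simp add: L2_def)
  have "ip M (Q B u) w = ip (spec u) (indicator B) h" if B: "B \<in> sets borel" for B
  proof -
    have "integral\<^sup>L (spec u) (\<lambda>x. indicator B x * h x) = enn2real (\<integral>\<^sup>+x. ennreal (indicator B x * h x) \<partial>spec u)"
      using B h0 by (intro integral_eq_nn_integral) auto
    also have "(\<integral>\<^sup>+x. ennreal (indicator B x * h x) \<partial>spec u) = ennreal (ip M (Q B u) w)"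
      unfolding pairing_density[OF B] by (intro nn_integral_cong) (auto simp: indicator_def)
    finally show ?thesis using nonneg[OF B] by (simp add: ip_def)
  qed
  with hL2 show ?thesis by blast
qed

text \<open>
  Polarization writes the signed measure \<open>\<langle>Q B u, g\<rangle>\<close> as a difference of two finite measures. For a
  Hahn set \<open>Y\<close> of this difference, pairing with \<open>Q Y g\<close> and with \<open>- Q (- Y) g\<close> gives two nonnegative
  measures, to which the previous lemma applies.
\<close>

lemma pairing_has_L2_density:
  assumes u: "u \<in> L2 M" and g: "g \<in> L2 M"
  shows "\<exists>h\<in>L2 (spec u). \<forall>B\<in>sets borel. ip M (Q B u) g = ip (spec u) (indicator B) h"
proof -
  define p where "p = (\<lambda>x. u x + g x)"
  define q where "q = (\<lambda>x. u x - g x)"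
  have pL2: "p \<in> L2 M" and qL2: "q \<in> L2 M"
    unfolding p_def q_def using L2_add[OF u g] L2_diff[OF u g] by auto
  have polar: "4 * ip M (Q B u) g = measure (spec p) B - measure (spec q) B" if B: "B \<in> sets borel" for B
  proof -
    have c: "ip M (Q B g) u = ip M (Q B u) g"
      using proj_sym[OF B g u] by (simp add: ip_commute)
    have 1: "ip M (Q B p) v = ip M (Q B u) v + ip M (Q B g) v"
      and 2: "ip M (Q B q) v = ip M (Q B u) v - ip M (Q B g) v" if "v \<in> L2 M" for v
      using ip_proj_lincomb[OF B u g that, of 1 1] ip_proj_lincomb[OF B u g that, of 1 "-1"]
      by (simp_all add: p_def q_def)
    have 3: "ip M v p = ip M v u + ip M v g" and 4: "ip M v q = ip M v u - ip M v g" if "v \<in> L2 M" for v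
      using ip_add_left[OF u g that] ip_diff_left[OF u g that] by (simp_all add: p_def q_def ip_commute)
    show ?thesis
      using B u g pL2 qL2 by (simp add: measure_spec 1 2 3 4 c)
  qed
  obtain Y where Y: "Y \<in> sets borel"
    and pos: "\<And>B. B \<in> sets borel \<Longrightarrow> B \<subseteq> Y \<Longrightarrow> emeasure (spec q) B \<le> emeasure (spec p) B"
    and neg: "\<And>B. B \<in> sets borel \<Longrightarrow> B \<inter> Y = {} \<Longrightarrow> emeasure (spec p) B \<le> emeasure (spec q) B"
    using finite_unsigned_Hahn_decomposition[OF finite_measure_spec[OF pL2] finite_measure_spec[OF qL2]]
    by auto
  have Yc: "- Y \<in> sets borel" using Y by (metis sets.compl_sets space_borel Compl_eq_Diff_UNIV)
  have pos': "0 \<le> ip M (Q B u) g" if "B \<in> sets borel" "B \<subseteq> Y" for B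
    using pos[OF that] polar[OF that(1)] pL2 qL2 that(1)
    by (simp add: emeasure_spec measure_spec ennreal_le_iff ip_proj_nonneg)
  have neg': "ip M (Q B u) g \<le> 0" if "B \<in> sets borel" "B \<inter> Y = {}" for B
    using neg[OF that] polar[OF that(1)] pL2 qL2 that(1)
    by (simp add: emeasure_spec measure_spec ennreal_le_iff ip_proj_nonneg)
  have ip1: "ip M (Q B u) (Q Y g) = ip M (Q (B \<inter> Y) u) g" if "B \<in> sets borel" for B
    using that Y u g by (rule ip_proj_proj)
  have ip2: "ip M (Q B u) (\<lambda>x. -1 * Q (- Y) g x) = - ip M (Q (B \<inter> - Y) u) g" if "B \<in> sets borel" for B
    using ip_cmult_left[OF proj_L2[OF Yc g] proj_L2[OF that u], of "-1"] ip_proj_proj[OF that Yc u g]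
    by (simp add: ip_commute)
  obtain h1 where h1: "h1 \<in> L2 (spec u)"
    "\<And>B. B \<in> sets borel \<Longrightarrow> ip M (Q B u) (Q Y g) = ip (spec u) (indicator B) h1"
    using nonneg_pairing_has_L2_density[OF u proj_L2[OF Y g]] ip1 pos' Y by auto
  have "\<exists>h\<in>L2 (spec u). \<forall>B\<in>sets borel.
      ip M (Q B u) (\<lambda>x. -1 * Q (- Y) g x) = ip (spec u) (indicator B) h"
  proof (rule nonneg_pairing_has_L2_density[OF u L2_cmult[OF proj_L2[OF Yc g]]])
    fix B :: "real set" assume B: "B \<in> sets borel"
    have "ip M (Q (B \<inter> - Y) u) g \<le> 0" using B Yc by (intro neg') auto
    then show "0 \<le> ip M (Q B u) (\<lambda>x. -1 * Q (- Y) g x)" by (simp only: ip2[OF B])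
  qed
  then obtain h2 where h2: "h2 \<in> L2 (spec u)"
    "\<And>B. B \<in> sets borel \<Longrightarrow> ip M (Q B u) (\<lambda>x. -1 * Q (- Y) g x) = ip (spec u) (indicator B) h2"
    by auto
  have "ip M (Q B u) g = ip (spec u) (indicator B) (\<lambda>x. h1 x - h2 x)" if B: "B \<in> sets borel" for B
  proof -
    have e: "(B \<inter> Y) \<union> (B \<inter> - Y) = B" by auto
    have "ip M (Q B u) g = ip M (Q (B \<inter> Y) u) g + ip M (Q (B \<inter> - Y) u) g"
      using ip_proj_Un[of "B \<inter> Y" "B \<inter> - Y" u g] B Y Yc u g unfolding e by blast
    also have "\<dots> = ip (spec u) (indicator B) h1 - ip (spec u) (indicator B) h2"
      using ip1[OF B] ip2[OF B] h1(2)[OF B] h2(2)[OF B] by linarith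
    also have "\<dots> = ip (spec u) (indicator B) (\<lambda>x. h1 x - h2 x)"
      using ip_diff_left[OF h1(1) h2(1) indicator_L2_spec[OF u B]] by (simp add: ip_commute)
    finally show ?thesis .
  qed
  with L2_diff[OF h1(1) h2(1)] show ?thesis by blast
qed

section \<open>Operators as multipliers on the spectral side\<close>

definition pairing_density :: "('a \<Rightarrow> real) \<Rightarrow> ('a \<Rightarrow> real) \<Rightarrow> real \<Rightarrow> real" where
  "pairing_density u g = (SOME h. h \<in> L2 (spec u) \<and>
     (\<forall>B\<in>sets borel. ip M (Q B u) g = ip (spec u) (indicator B) h))"

lemma
  assumes "u \<in> L2 M" "g \<in> L2 M"
  shows dens_L2: "pairing_density u g \<in> L2 (spec u)"
    and ip_proj_dens: "B \<in> sets borel \<Longrightarrow> ip M (Q B u) g = ip (spec u) (indicator B) (pairing_density u g)"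
proof -
  from pairing_has_L2_density[OF assms]
  have "\<exists>h. h \<in> L2 (spec u) \<and> (\<forall>B\<in>sets borel. ip M (Q B u) g = ip (spec u) (indicator B) h)"
    by blast
  then have *: "pairing_density u g \<in> L2 (spec u) \<and>
     (\<forall>B\<in>sets borel. ip M (Q B u) g = ip (spec u) (indicator B) (pairing_density u g))"
    unfolding pairing_density_def by (rule someI_ex)
  show "pairing_density u g \<in> L2 (spec u)" using * by blast
  show "ip M (Q B u) g = ip (spec u) (indicator B) (pairing_density u g)" if "B \<in> sets borel"
    using * that by blast
qed

lemma one_L2_spec: "u \<in> L2 M \<Longrightarrow> (\<lambda>x. 1) \<in> L2 (spec u)"
  by (rule bounded_L2_spec[where C = 1]) auto

lemma L2_spec_integrable:
  assumes "u \<in> L2 M" "\<phi> \<in> L2 (spec u)" shows "integrable (spec u) \<phi>"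
  using L2_integrable_mult[OF one_L2_spec[OF assms(1)] assms(2)] by simp

lemma AE_dens_eq:
  assumes u: "u \<in> L2 M" and g: "g \<in> L2 M" and k: "k \<in> L2 (spec u)"
    and eq: "\<And>B. B \<in> sets borel \<Longrightarrow> ip M (Q B u) g = ip (spec u) (indicator B) k"
  shows "AE x in spec u. pairing_density u g x = k x"
proof (rule density_unique_real)
  show "integrable (spec u) (pairing_density u g)" "integrable (spec u) k"
    using L2_spec_integrable dens_L2 u g k by auto
  fix B assume "B \<in> sets (spec u)"
  then show "(LINT x:B|spec u. pairing_density u g x) = (LINT x:B|spec u. k x)"
    using eq[of B] ip_proj_dens[OF u g, of B] by (simp add: ip_def set_lebesgue_integral_def)
qed

lemma ip_dens_eq:
  assumes u: "u \<in> L2 M" and g: "g \<in> L2 M" and k: "k \<in> L2 (spec u)"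
    and eq: "\<And>B. B \<in> sets borel \<Longrightarrow> ip M (Q B u) g = ip (spec u) (indicator B) k"
    and \<phi>: "\<phi> \<in> L2 (spec u)"
  shows "ip (spec u) \<phi> (pairing_density u g) = ip (spec u) \<phi> k"
  using ip_cong_AE[OF dens_L2[OF u g] k \<phi> AE_dens_eq[OF u g k eq]] by (simp add: ip_commute)

lemma ip_indicator: "ip m (indicator B) (indicator C) = (LINT x|m. indicator (B \<inter> C) x)"
  by (simp add: ip_def indicator_inter_arith)

lemma ip_dens_proj:
  assumes u: "u \<in> L2 M" and g: "g \<in> L2 M" and B: "B \<in> sets borel" and \<phi>: "\<phi> \<in> L2 (spec u)"
  shows "ip (spec u) \<phi> (pairing_density u (Q B g)) = ip (spec u) \<phi> (\<lambda>x. indicator B x * pairing_density u g x)"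
proof (rule ip_dens_eq[OF u proj_L2[OF B g] _ _ \<phi>])
  have d: "pairing_density u g \<in> L2 (spec u)" by (rule dens_L2[OF u g])
  have "integrable (spec u) (\<lambda>x. indicator B x * (pairing_density u g x)\<^sup>2)"
    using integrable_mult_indicator[of B "spec u" "\<lambda>x. (pairing_density u g x)\<^sup>2"] d B by (simp add: L2_def)
  moreover have "indicator B x * (pairing_density u g x)\<^sup>2 = (indicator B x * pairing_density u g x)\<^sup>2" for x
    by (simp add: indicator_def)
  ultimately show "(\<lambda>x. indicator B x * pairing_density u g x) \<in> L2 (spec u)"
    using d B by (auto simp: L2_def)
  fix C :: "real set" assume C: "C \<in> sets borel"
  have "ip M (Q C u) (Q B g) = ip M (Q (C \<inter> B) u) g"
    by (rule ip_proj_proj[OF C B u g])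
  also have "\<dots> = ip (spec u) (indicator (C \<inter> B)) (pairing_density u g)"
    using B C by (intro ip_proj_dens[OF u g]) auto
  finally have "ip M (Q C u) (Q B g) = ip (spec u) (indicator (C \<inter> B)) (pairing_density u g)" .
  then show "ip M (Q C u) (Q B g) = ip (spec u) (indicator C) (\<lambda>x. indicator B x * pairing_density u g x)"
    by (simp add: ip_def indicator_inter_arith mult.assoc)
qed

text \<open>
  The relation says that \<open>w = \<phi>(A) u\<close> for the operator \<open>A\<close> with resolution \<open>Q\<close>. It is formulated
  through pairings only, because elements of \<open>L\<^sup>2\<close> are determined almost everywhere, and \<open>w\<close> is an
  arbitrary representative.
\<close>

definition represents :: "(real \<Rightarrow> real) \<Rightarrow> ('a \<Rightarrow> real) \<Rightarrow> ('a \<Rightarrow> real) \<Rightarrow> bool" where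
  "represents \<phi> u w \<longleftrightarrow> \<phi> \<in> L2 (spec u) \<and> w \<in> L2 M \<and>
     (\<forall>g\<in>L2 M. ip M w g = ip (spec u) \<phi> (pairing_density u g))"

lemma representsD:
  assumes "represents \<phi> u w"
  shows "\<phi> \<in> L2 (spec u)" "w \<in> L2 M" "\<And>g. g \<in> L2 M \<Longrightarrow> ip M w g = ip (spec u) \<phi> (pairing_density u g)"
  using assms by (auto simp: represents_def)

lemma represents_indicator:
  assumes "u \<in> L2 M" "B \<in> sets borel" shows "represents (indicator B) u (Q B u)"
  using assms by (auto simp: represents_def ip_proj_dens indicator_L2_spec)

lemma represents_one:
  assumes "u \<in> L2 M" shows "represents (\<lambda>x. 1) u u"
proof -
  have "ip M u g = ip (spec u) (\<lambda>x. 1) (pairing_density u g)" if "g \<in> L2 M" for g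
    using ip_proj_dens[OF assms that, of UNIV] ip_proj_UNIV[OF assms that]
    by (simp add: ip_def)
  then show ?thesis using assms by (simp add: represents_def one_L2_spec)
qed

lemma represents_lincomb:
  assumes u: "u \<in> L2 M" and "represents \<phi> u w" "represents \<psi> u v"
  shows "represents (\<lambda>x. b * \<phi> x + c * \<psi> x) u (\<lambda>x. b * w x + c * v x)"
  unfolding represents_def
  using representsD[OF assms(2)] representsD[OF assms(3)] dens_L2[OF u]
  by (auto simp: ip_lincomb_left L2_lincomb)

lemma represents_sum:
  assumes u: "u \<in> L2 M" and "finite I" and B: "\<And>i. i \<in> I \<Longrightarrow> B i \<in> sets borel"
  shows "\<exists>w. represents (\<lambda>x. \<Sum>i\<in>I. c i * indicator (B i) x) u w"
  using assms(2,3)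
proof (induction I)
  case empty
  have "represents (\<lambda>x. 0) u (\<lambda>x. 0)"
    using represents_lincomb[OF u represents_one[OF u] represents_one[OF u], of 0 0] by simp
  then show ?case by auto
next
  case (insert i I)
  then obtain w where "represents (\<lambda>x. \<Sum>i\<in>I. c i * indicator (B i) x) u w" by auto
  from represents_lincomb[OF u represents_indicator[OF u, of "B i"] this, of "c i" 1] insert
  have "\<exists>w. represents (\<lambda>x. c i * indicator (B i) x + 1 * (\<Sum>i\<in>I. c i * indicator (B i) x)) u w"
    by blast
  moreover have "(\<lambda>x. \<Sum>i\<in>insert i I. c i * indicator (B i) x)
      = (\<lambda>x. c i * indicator (B i) x + 1 * (\<Sum>i\<in>I. c i * indicator (B i) x))"
    by (simp only: sum.insert[OF insert.hyps] mult_1_left)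
  ultimately show ?case by simp
qed

lemma represents_simple:
  assumes u: "u \<in> L2 M" and \<phi>: "simple_function (spec u) (\<phi> :: real \<Rightarrow> real)"
  shows "\<exists>w. represents \<phi> u w"
proof -
  have fin: "finite (range \<phi>)" using simple_functionD(1)[OF \<phi>] by simp
  have "\<phi> -` {c} \<in> sets borel" for c using simple_functionD(2)[OF \<phi>, of "{c}"] by simp
  from represents_sum[OF u fin this, of "\<lambda>c. c" "\<lambda>c. c"]
  obtain w where w: "represents (\<lambda>x. \<Sum>c\<in>range \<phi>. c * indicator (\<phi> -` {c}) x) u w" by blast
  have "(\<Sum>c\<in>range \<phi>. c * indicator (\<phi> -` {c}) x) = (\<Sum>c\<in>range \<phi>. if c = \<phi> x then c else 0)" for x
    by (intro sum.cong) (auto simp: indicator_def)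
  then have "(\<lambda>x. \<Sum>c\<in>range \<phi>. c * indicator (\<phi> -` {c}) x) = \<phi>"
    using fin by (auto simp: sum.delta)
  with w show ?thesis by auto
qed

text \<open>
  On the spectral side \<open>u\<close> generates a copy of \<open>L\<^sup>2(m\<^sub>u)\<close>: an element \<open>\<phi>(A) u\<close> has density \<open>\<phi>\<close> with
  respect to \<open>u\<close>. This makes \<open>\<phi> \<mapsto> \<phi>(A) u\<close> an isometry.
\<close>

lemma AE_dens_represents:
  assumes u: "u \<in> L2 M" and w: "represents \<phi> u w"
  shows "AE x in spec u. pairing_density u w x = \<phi> x"
proof (rule AE_dens_eq[OF u representsD(2)[OF w] representsD(1)[OF w]])
  fix B :: "real set" assume B: "B \<in> sets borel"
  have "ip M (Q B u) w = ip (spec u) \<phi> (pairing_density u (Q B u))"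
    using representsD(3)[OF w proj_L2[OF B u]] by (simp add: ip_commute)
  also have "\<dots> = ip (spec u) \<phi> (indicator B)"
  proof (rule ip_dens_eq[OF u proj_L2[OF B u] indicator_L2_spec[OF u B] _ representsD(1)[OF w]])
    fix C :: "real set" assume C: "C \<in> sets borel"
    show "ip M (Q C u) (Q B u) = ip (spec u) (indicator C) (indicator B)"
      using B C u by (simp add: ip_proj_proj ip_indicator measure_spec)
  qed
  finally show "ip M (Q B u) w = ip (spec u) (indicator B) \<phi>" by (simp add: ip_commute)
qed

lemma ip_represents_self:
  assumes u: "u \<in> L2 M" and w: "represents \<phi> u w"
  shows "ip M w w = ip (spec u) \<phi> \<phi>"
proof -
  have "ip M w w = ip (spec u) (pairing_density u w) \<phi>"
    using representsD[OF w] by (simp add: ip_commute)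
  also have "\<dots> = ip (spec u) \<phi> \<phi>"
    using AE_dens_represents[OF assms] representsD[OF w] dens_L2[OF u]
    by (intro ip_cong_AE) auto
  finally show ?thesis .
qed

lemma simple_approximation_L2:
  assumes "\<phi> \<in> L2 m"
  obtains \<psi> :: "nat \<Rightarrow> 'b \<Rightarrow> real" where "\<And>n. simple_function m (\<psi> n)" "\<And>n. \<psi> n \<in> L2 m"
    "(\<lambda>n. ip m (\<lambda>x. \<psi> n x - \<phi> x) (\<lambda>x. \<psi> n x - \<phi> x)) \<longlonglongrightarrow> 0"
proof -
  have \<phi> [measurable]: "\<phi> \<in> borel_measurable m" and i: "integrable m (\<lambda>x. (\<phi> x)\<^sup>2)"
    using assms by (auto simp: L2_def)
  obtain \<psi> where \<psi>: "\<forall>n. simple_function m (\<psi> n)" "\<forall>x\<in>space m. (\<lambda>n. \<psi> n x) \<longlonglongrightarrow> \<phi> x"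
    "\<forall>n. \<forall>x\<in>space m. dist (\<psi> n x) 0 \<le> 2 * dist (\<phi> x) 0"
    using borel_measurable_implies_sequence_metric[OF \<phi>, of 0] by blast
  have s: "\<And>n. simple_function m (\<psi> n)"
    and lim: "\<And>x. x \<in> space m \<Longrightarrow> (\<lambda>n. \<psi> n x) \<longlonglongrightarrow> \<phi> x"
    and bd: "\<And>n x. x \<in> space m \<Longrightarrow> \<bar>\<psi> n x\<bar> \<le> 2 * \<bar>\<phi> x\<bar>"
    using \<psi> by auto
  have [measurable]: "\<psi> n \<in> borel_measurable m" for n
    by (rule borel_measurable_simple_function[OF s])
  have "(\<psi> n x)\<^sup>2 \<le> 4 * (\<phi> x)\<^sup>2" if "x \<in> space m" for n x
    using power_mono[OF bd[OF that, of n], of 2] by (simp add: power_mult_distrib)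
  then have "AE x in m. norm ((\<psi> n x)\<^sup>2) \<le> norm (4 * (\<phi> x)\<^sup>2)" for n by auto
  then have "integrable m (\<lambda>x. (\<psi> n x)\<^sup>2)" for n
    by (rule Bochner_Integration.integrable_bound[OF integrable_mult_right[OF i], rotated]) simp
  then have L: "\<psi> n \<in> L2 m" for n by (simp add: L2_def)
  have "(\<lambda>n. LINT x|m. (\<psi> n x - \<phi> x) * (\<psi> n x - \<phi> x)) \<longlonglongrightarrow> (LINT x|m. 0)"
  proof (rule integral_dominated_convergence[where w = "\<lambda>x. 9 * (\<phi> x)\<^sup>2"])
    show "integrable m (\<lambda>x. 9 * (\<phi> x)\<^sup>2)" using i by simp
    show "AE x in m. (\<lambda>n. (\<psi> n x - \<phi> x) * (\<psi> n x - \<phi> x)) \<longlonglongrightarrow> 0"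
    proof (rule AE_I2)
      fix x assume "x \<in> space m"
      then have "(\<lambda>n. (\<psi> n x - \<phi> x) * (\<psi> n x - \<phi> x)) \<longlonglongrightarrow> (\<phi> x - \<phi> x) * (\<phi> x - \<phi> x)"
        by (intro tendsto_intros lim)
      then show "(\<lambda>n. (\<psi> n x - \<phi> x) * (\<psi> n x - \<phi> x)) \<longlonglongrightarrow> 0" by simp
    qed
    show "AE x in m. norm ((\<psi> n x - \<phi> x) * (\<psi> n x - \<phi> x)) \<le> 9 * (\<phi> x)\<^sup>2" for n
    proof (rule AE_I2)
      fix x assume x: "x \<in> space m"
      have "\<bar>\<psi> n x - \<phi> x\<bar> \<le> 3 * \<bar>\<phi> x\<bar>" using bd[OF x, of n] by linarith
      from power_mono[OF this, of 2]
      show "norm ((\<psi> n x - \<phi> x) * (\<psi> n x - \<phi> x)) \<le> 9 * (\<phi> x)\<^sup>2"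
        by (simp add: power_mult_distrib power2_eq_square)
    qed
  qed auto
  then show thesis using s L by (intro that) (auto simp: ip_def)
qed

text \<open>
  For simple functions the element is a finite combination of projections of \<open>u\<close>. Simple functions
  are dense in \<open>L\<^sup>2(m\<^sub>u)\<close>, the correspondence is isometric, and \<open>L\<^sup>2\<close> is complete.
\<close>

theorem ex_represents:
  assumes u: "u \<in> L2 M" and \<phi>: "\<phi> \<in> L2 (spec u)"
  shows "\<exists>w. represents \<phi> u w"
proof -
  obtain \<psi> where s: "\<And>n. simple_function (spec u) (\<psi> n)" and L: "\<And>n. \<psi> n \<in> L2 (spec u)"
    and lim: "(\<lambda>n. ip (spec u) (\<lambda>x. \<psi> n x - \<phi> x) (\<lambda>x. \<psi> n x - \<phi> x)) \<longlonglongrightarrow> 0"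
    using simple_approximation_L2[OF \<phi>] by blast
  have "\<forall>n. \<exists>w. represents (\<psi> n) u w" using represents_simple[OF u s] by blast
  then obtain w where w: "\<And>n. represents (\<psi> n) u (w n)" by metis
  let ?d = "\<lambda>n. ip (spec u) (\<lambda>x. \<psi> n x - \<phi> x) (\<lambda>x. \<psi> n x - \<phi> x)"
  have "ip M (\<lambda>x. w m x - w n x) (\<lambda>x. w m x - w n x) \<le> 2 * ?d m + 2 * ?d n" for m n
  proof -
    have i: "integrable (spec u) (\<lambda>x. (\<psi> k x - \<phi> x) * (\<psi> k x - \<phi> x))" for k
      by (rule L2_integrable_mult; rule L2_diff[OF L \<phi>])
    have "ip M (\<lambda>x. w m x - w n x) (\<lambda>x. w m x - w n x)
        = ip (spec u) (\<lambda>x. \<psi> m x - \<psi> n x) (\<lambda>x. \<psi> m x - \<psi> n x)"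
      using ip_represents_self[OF u represents_lincomb[OF u w[of m] w[of n], of 1 "-1"]] by simp
    also have "\<dots> \<le> (LINT x|spec u. 2 * ((\<psi> m x - \<phi> x) * (\<psi> m x - \<phi> x)) + 2 * ((\<psi> n x - \<phi> x) * (\<psi> n x - \<phi> x)))"
      unfolding ip_def
    proof (rule integral_mono)
      show "integrable (spec u) (\<lambda>x. (\<psi> m x - \<psi> n x) * (\<psi> m x - \<psi> n x))"
        by (rule L2_integrable_mult; rule L2_diff[OF L L])
      show "integrable (spec u) (\<lambda>x. 2 * ((\<psi> m x - \<phi> x) * (\<psi> m x - \<phi> x)) + 2 * ((\<psi> n x - \<phi> x) * (\<psi> n x - \<phi> x)))"
        using i by simp
      have "(a - b) * (a - b) \<le> 2 * ((a - c) * (a - c)) + 2 * ((b - c) * (b - c))" for a b c :: real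
        using zero_le_power2[of "a + b - 2 * c"] by (simp add: power2_eq_square algebra_simps)
      then show "(\<psi> m x - \<psi> n x) * (\<psi> m x - \<psi> n x)
          \<le> 2 * ((\<psi> m x - \<phi> x) * (\<psi> m x - \<phi> x)) + 2 * ((\<psi> n x - \<phi> x) * (\<psi> n x - \<phi> x))" for x .
    qed
    also have "\<dots> = 2 * ?d m + 2 * ?d n"
      using i by (simp add: ip_def)
    finally show ?thesis .
  qed
  note cau = this
  obtain v where v: "v \<in> L2 M" "(\<lambda>n. ip M (\<lambda>x. w n x - v x) (\<lambda>x. w n x - v x)) \<longlonglongrightarrow> 0"
  proof (rule Riesz_Fischer_L2[where w = w])
    show "w n \<in> L2 M" for n using representsD(2)[OF w] .
    fix \<epsilon> :: real assume "0 < \<epsilon>"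
    then have "eventually (\<lambda>n. ?d n < \<epsilon> / 4) sequentially"
      using order_tendstoD(2)[OF lim, of "\<epsilon> / 4"] by simp
    then obtain N where N: "\<And>n. n \<ge> N \<Longrightarrow> ?d n < \<epsilon> / 4" by (auto simp: eventually_sequentially)
    have "ip M (\<lambda>x. w m x - w n x) (\<lambda>x. w m x - w n x) < \<epsilon>" if "m \<ge> N" "n \<ge> N" for m n
      using cau[of m n] N[OF that(1)] N[OF that(2)] by linarith
    then show "\<exists>N. \<forall>m\<ge>N. \<forall>n\<ge>N. ip M (\<lambda>x. w m x - w n x) (\<lambda>x. w m x - w n x) < \<epsilon>" by blast
  qed blast
  have "ip M v g = ip (spec u) \<phi> (pairing_density u g)" if g: "g \<in> L2 M" for g
  proof -
    have "(\<lambda>n. ip M (w n) g) \<longlonglongrightarrow> ip M v g"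
      by (rule ip_tendsto[OF representsD(2)[OF w] v(1) g v(2)])
    moreover have "(\<lambda>n. ip (spec u) (\<psi> n) (pairing_density u g)) \<longlonglongrightarrow> ip (spec u) \<phi> (pairing_density u g)"
      by (rule ip_tendsto[OF L \<phi> dens_L2[OF u g] lim])
    ultimately show ?thesis
      using representsD(3)[OF w g] by (simp add: LIMSEQ_unique)
  qed
  then have "represents \<phi> u v" using v \<phi> by (simp add: represents_def)
  then show ?thesis by blast
qed

lemma ip_proj_represents:
  assumes u: "u \<in> L2 M" and w: "represents \<phi> u w" and g: "g \<in> L2 M" and B: "B \<in> sets borel"
  shows "ip M (Q B w) g = (LINT x|spec u. indicator B x * (\<phi> x * pairing_density u g x))"
proof -
  have "ip M (Q B w) g = ip (spec u) \<phi> (pairing_density u (Q B g))"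
    using representsD[OF w] B g by (simp add: proj_sym)
  also have "\<dots> = ip (spec u) \<phi> (\<lambda>x. indicator B x * pairing_density u g x)"
    by (rule ip_dens_proj[OF u g B representsD(1)[OF w]])
  finally show ?thesis by (simp add: ip_def mult_ac)
qed

lemma spec_represents:
  assumes u: "u \<in> L2 M" and w: "represents \<phi> u w"
  shows "spec w = density (spec u) (\<lambda>x. ennreal ((\<phi> x)\<^sup>2))"
proof (rule measure_eqI)
  note wL = representsD(2)[OF w] and \<phi>L = representsD(1)[OF w]
  have [measurable]: "\<phi> \<in> borel_measurable (spec u)" "pairing_density u w \<in> borel_measurable (spec u)"
    using \<phi>L dens_L2[OF u wL] by (auto simp: L2_def)
  fix B assume "B \<in> sets (spec w)"
  then have B: "B \<in> sets borel" by simp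
  have i: "integrable (spec u) (\<lambda>x. indicator B x * (\<phi> x)\<^sup>2)"
    using integrable_mult_indicator[of B "spec u" "\<lambda>x. (\<phi> x)\<^sup>2"] \<phi>L B by (simp add: L2_def)
  have "ip M (Q B w) w = (LINT x|spec u. indicator B x * (\<phi> x)\<^sup>2)"
    unfolding ip_proj_represents[OF u w wL B]
    using AE_dens_represents[OF u w] B by (intro integral_cong_AE) (auto simp: power2_eq_square)
  then have "emeasure (spec w) B = (\<integral>\<^sup>+x. ennreal (indicator B x * (\<phi> x)\<^sup>2) \<partial>spec u)"
    using nn_integral_eq_integral[OF i] by (simp add: emeasure_spec[OF wL B])
  also have "\<dots> = (\<integral>\<^sup>+x. ennreal ((\<phi> x)\<^sup>2) * indicator B x \<partial>spec u)"
    by (intro nn_integral_cong) (auto simp: indicator_def)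
  also have "\<dots> = emeasure (density (spec u) (\<lambda>x. ennreal ((\<phi> x)\<^sup>2))) B"
    using B by (intro emeasure_density[symmetric]) auto
  finally show "emeasure (spec w) B = emeasure (density (spec u) (\<lambda>x. ennreal ((\<phi> x)\<^sup>2))) B" .
qed simp

lemma spectral_integral_represents:
  assumes u: "u \<in> L2 M" and w: "represents \<phi> u w" and g: "g \<in> L2 M"
    and \<psi>: "\<psi> \<in> borel_measurable borel" and \<psi>\<phi>: "(\<lambda>x. \<psi> x * \<phi> x) \<in> L2 (spec u)"
  shows "spectral_integral M Q \<psi> w g = ip (spec u) (\<lambda>x. \<psi> x * \<phi> x) (pairing_density u g)"
proof -
  have "spectral_integral M Q \<psi> w g = (LINT x|spec u. \<psi> x * (\<phi> x * pairing_density u g x))"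
    unfolding spectral_integral_def
  proof (rule signed_integral_density[OF sets_spec _ ip_proj_represents[OF u w g] \<psi>])
    show "integrable (spec u) (\<lambda>x. \<phi> x * pairing_density u g x)"
      by (rule L2_integrable_mult[OF representsD(1)[OF w] dens_L2[OF u g]])
    show "integrable (spec u) (\<lambda>x. \<psi> x * (\<phi> x * pairing_density u g x))"
      using L2_integrable_mult[OF \<psi>\<phi> dens_L2[OF u g]] by (simp add: mult.assoc)
  qed
  then show ?thesis by (simp add: ip_def mult.assoc)
qed

text \<open>
  Functional calculus is multiplicative: pairings of \<open>w = \<phi>(A) u\<close> with \<open>Q B g\<close> have density \<open>\<phi> h\<close> on
  \<open>B\<close>, where \<open>h\<close> is the density of the pairing of \<open>u\<close> with \<open>g\<close>, so integrating \<open>\<psi>\<close> against them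
  integrates \<open>\<psi> \<phi> h\<close>. The element chosen by \<^const>\<open>spectral_op\<close> exists because \<open>\<psi> \<phi>\<close> is
  represented by some element.
\<close>

theorem spectral_op_represents:
  assumes u: "u \<in> L2 M" and w: "represents \<phi> u w"
    and \<psi>: "\<psi> \<in> borel_measurable borel" and \<psi>\<phi>: "(\<lambda>x. \<psi> x * \<phi> x) \<in> L2 (spec u)"
  shows "represents (\<lambda>x. \<psi> x * \<phi> x) u (spectral_op M Q \<psi> w)"
proof -
  obtain v where v: "represents (\<lambda>x. \<psi> x * \<phi> x) u v" using ex_represents[OF u \<psi>\<phi>] by blast
  have "spectral_op M Q \<psi> w \<in> L2 M \<and>
      (\<forall>g\<in>L2 M. ip M (spectral_op M Q \<psi> w) g = spectral_integral M Q \<psi> w g)"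
    unfolding spectral_op_def
    by (rule someI[of _ v])
      (use representsD[OF v] spectral_integral_represents[OF u w _ \<psi> \<psi>\<phi>] in auto)
  then show ?thesis
    using spectral_integral_represents[OF u w _ \<psi> \<psi>\<phi>] \<psi>\<phi> by (simp add: represents_def)
qed

lemma spectral_domain_represents:
  assumes u: "u \<in> L2 M" and w: "represents \<phi> u w"
    and \<psi>: "\<psi> \<in> borel_measurable borel" and \<psi>\<phi>: "(\<lambda>x. \<psi> x * \<phi> x) \<in> L2 (spec u)"
  shows "w \<in> spectral_domain M Q \<psi>"
proof -
  have [measurable]: "\<phi> \<in> borel_measurable (spec u)" "\<psi> \<in> borel_measurable (spec u)"
    using representsD(1)[OF w] \<psi> by (auto simp: L2_def)
  have "(\<integral>\<^sup>+l. ennreal ((\<psi> l)\<^sup>2) \<partial>spec w) = (\<integral>\<^sup>+l. ennreal ((\<phi> l)\<^sup>2) * ennreal ((\<psi> l)\<^sup>2) \<partial>spec u)"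
    unfolding spec_represents[OF u w] by (rule nn_integral_density) auto
  also have "\<dots> = (\<integral>\<^sup>+l. ennreal ((\<psi> l * \<phi> l)\<^sup>2) \<partial>spec u)"
    by (intro nn_integral_cong) (simp add: ennreal_mult[symmetric] power_mult_distrib mult.commute)
  also have "\<dots> < \<infinity>"
    using \<psi>\<phi> by (subst nn_integral_eq_integral) (auto simp: L2_def)
  finally show ?thesis using representsD(2)[OF w] by (simp add: spectral_domain_def)
qed

end

section \<open>The Bessel type integral and its recurrence\<close>

text \<open>
  By the mean value theorem the difference quotients are bounded by the majorant of the derivative,
  so dominated convergence applies along every sequence tending to \<open>y0\<close>.
\<close>

lemma has_derivative_under_integral:
  fixes F F' :: "real \<Rightarrow> 'b \<Rightarrow> real"
  assumes y0: "y0 \<in> {a<..<b}"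
    and int: "\<And>y. y \<in> {a<..<b} \<Longrightarrow> integrable m (F y)"
    and deriv: "\<And>y x. y \<in> {a<..<b} \<Longrightarrow> x \<in> space m \<Longrightarrow>
      ((\<lambda>y. F y x) has_real_derivative F' y x) (at y)"
    and bound: "\<And>y x. y \<in> {a<..<b} \<Longrightarrow> x \<in> space m \<Longrightarrow> \<bar>F' y x\<bar> \<le> w x"
    and w: "integrable m w" and F' [measurable]: "F' y0 \<in> borel_measurable m"
  shows "((\<lambda>y. LINT x|m. F y x) has_real_derivative (LINT x|m. F' y0 x)) (at y0)"
proof -
  have [measurable]: "F y \<in> borel_measurable m" if "y \<in> {a<..<b}" for y
    using int[OF that] by simp
  have nb: "eventually (\<lambda>y. y \<in> {a<..<b}) (at y0)"
    using y0 eventually_at_in_open'[of "{a<..<b}" y0] by simp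
  have "((\<lambda>y. ((LINT x|m. F y x) - (LINT x|m. F y0 x)) / (y - y0)) \<longlongrightarrow> (LINT x|m. F' y0 x)) (at y0)"
    unfolding tendsto_at_iff_sequentially
  proof (intro allI impI, unfold comp_def)
    fix X :: "nat \<Rightarrow> real"
    assume X: "\<forall>i. X i \<in> UNIV - {y0}" "X \<longlonglongrightarrow> y0"
    then have Xat: "filterlim X (at y0) sequentially" by (auto simp: filterlim_at)
    have ev: "eventually (\<lambda>i. X i \<in> {a<..<b}) sequentially"
      using filterlim_iff[THEN iffD1, OF Xat] nb by blast
    then obtain N where N: "\<And>i. i \<ge> N \<Longrightarrow> X i \<in> {a<..<b}" by (auto simp: eventually_sequentially)
    let ?q = "\<lambda>i x. (F (X (i + N)) x - F y0 x) / (X (i + N) - y0)"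
    have "(\<lambda>i. LINT x|m. ?q i x) \<longlonglongrightarrow> (LINT x|m. F' y0 x)"
    proof (rule integral_dominated_convergence[where w = w])
      show "?q i \<in> borel_measurable m" for i using N[of "i + N"] y0 by measurable
      show "AE x in m. (\<lambda>i. ?q i x) \<longlonglongrightarrow> F' y0 x"
      proof (rule AE_I2)
        fix x assume x: "x \<in> space m"
        have "((\<lambda>y. (F y x - F y0 x) / (y - y0)) \<longlongrightarrow> F' y0 x) (at y0)"
          using deriv[OF y0 x] by (simp add: has_field_derivative_iff)
        from filterlim_compose[OF this Xat]
        show "(\<lambda>i. ?q i x) \<longlonglongrightarrow> F' y0 x" by (rule LIMSEQ_ignore_initial_segment)
      qed
      show "AE x in m. norm (?q i x) \<le> w x" for i
      proof (rule AE_I2)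
        fix x assume x: "x \<in> space m"
        let ?y = "X (i + N)"
        have y: "?y \<in> {a<..<b}" "?y \<noteq> y0" using N[of "i + N"] X(1) by auto
        have "norm (F ?y x - F y0 x) \<le> w x * norm (?y - y0)"
        proof (rule field_differentiable_bound[where S = "{a<..<b}"])
          show "((\<lambda>y. F y x) has_field_derivative F' z x) (at z within {a<..<b})" if "z \<in> {a<..<b}" for z
            using deriv[OF that x] by (rule DERIV_subset) simp
        qed (use bound x y y0 in auto)
        then show "norm (?q i x) \<le> w x" using y(2) by (simp add: divide_simps)
      qed
    qed (use w in auto)
    also have "(\<lambda>i. LINT x|m. ?q i x) =
        (\<lambda>i. ((LINT x|m. F (X (i + N)) x) - (LINT x|m. F y0 x)) / (X (i + N) - y0))"
      using int[OF N] int[OF y0] by simp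
    finally show "(\<lambda>i. ((LINT x|m. F (X i) x) - (LINT x|m. F y0 x)) / (X i - y0)) \<longlonglongrightarrow> (LINT x|m. F' y0 x)"
      by (rule LIMSEQ_offset)
  qed
  then show ?thesis by (simp add: has_field_derivative_iff)
qed

lemma lborel_change_of_variables_pos:
  fixes f g g' :: "real \<Rightarrow> real"
  assumes [measurable]: "f \<in> borel_measurable borel" "g \<in> borel_measurable borel" "g' \<in> borel_measurable borel"
    and deriv: "\<And>x. 0 < x \<Longrightarrow> (g has_real_derivative g' x) (at x)"
    and inj: "inj_on g {0<..}" and im: "g ` {0<..} = {0<..}"
    and f: "set_integrable lborel {0<..} f"
  shows "set_integrable lborel {0<..} (\<lambda>x. \<bar>g' x\<bar> * f (g x))"
    and "(LINT x:{0<..}|lborel. \<bar>g' x\<bar> * f (g x)) = (LINT x:{0<..}|lborel. f x)"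
proof -
  have leb: "set_integrable lebesgue {0<..} h \<longleftrightarrow> set_integrable lborel {0<..} h"
    "(LINT x:{0<..}|lebesgue. h x) = (LINT x:{0<..}|lborel. h x)"
    if [measurable]: "h \<in> borel_measurable borel" for h :: "real \<Rightarrow> real"
    unfolding set_integrable_def set_lebesgue_integral_def
    by (rule integrable_completion integral_completion; simp)+
  have fa: "f absolutely_integrable_on g ` {0<..}" using f leb(1)[of f] by (simp add: im)
  have d: "(g has_field_derivative g' x) (at x within {0<..})" if "x \<in> {0<..}" for x
    using deriv[of x] that by (auto intro: has_field_derivative_at_within)
  from has_absolute_integral_change_of_variables_1'[OF _ d inj, of f "integral (g ` {0<..}) f"] fa
  have c: "set_integrable lebesgue {0<..} (\<lambda>x. \<bar>g' x\<bar> * f (g x))"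
    "integral {0<..} (\<lambda>x. \<bar>g' x\<bar> * f (g x)) = integral {0<..} f"
    by (auto simp: im)
  show "set_integrable lborel {0<..} (\<lambda>x. \<bar>g' x\<bar> * f (g x))" using c(1) by (simp add: leb)
  show "(LINT x:{0<..}|lborel. \<bar>g' x\<bar> * f (g x)) = (LINT x:{0<..}|lborel. f x)"
    using c set_lebesgue_integral_eq_integral(2)[OF c(1)] set_lebesgue_integral_eq_integral(2)[OF fa]
    by (simp add: leb im)
qed

definition bessel_kernel :: "real \<Rightarrow> real \<Rightarrow> real \<Rightarrow> real" where
  "bessel_kernel p z t = exp (- t - z / (4 * t)) * t powr (p - 1)"

text \<open>
  If \<open>\<kappa>\<^sub>p\<close> is the modified Bessel function of the second kind, \<open>bessel_K p z = 2 (x/2)\<^sup>p \<kappa>\<^sub>p(x)\<close> with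
  \<open>x = \<surd>z\<close>, for \<open>z > 0\<close>. For \<open>z = 0\<close> and \<open>p > 0\<close> it is the Gamma integral.
\<close>

definition bessel_K :: "real \<Rightarrow> real \<Rightarrow> real" where
  "bessel_K p z = (LINT t:{0<..}|lborel. bessel_kernel p z t)"

lemma bessel_kernel_measurable [measurable]:
  "(\<lambda>t. bessel_kernel p z t) \<in> borel_measurable borel"
  unfolding bessel_kernel_def by measurable

lemma bessel_K_measurable [measurable]: "bessel_K p \<in> borel_measurable borel"
  unfolding bessel_K_def set_lebesgue_integral_def bessel_kernel_def
  by (rule lborel.borel_measurable_lebesgue_integral) measurable

lemma bessel_kernel_nonneg: "0 \<le> bessel_kernel p z t"
  by (simp add: bessel_kernel_def)

lemma bessel_K_nonneg: "0 \<le> bessel_K p z"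
  unfolding bessel_K_def set_lebesgue_integral_def
  by (rule integral_nonneg_AE) (auto simp: bessel_kernel_nonneg indicator_def)

lemma
  assumes "0 < p"
  shows bessel_kernel_0_integrable: "set_integrable lborel {0<..} (bessel_kernel p 0)"
    and bessel_K_0: "bessel_K p 0 = Gamma p"
proof -
  have "ennreal (Gamma p) = (\<integral>\<^sup>+t. ennreal (indicator {0..} t * t powr (p - 1) / exp t) \<partial>lborel)"
    by (rule Gamma_conv_nn_integral_real[OF assms])
  also have "\<dots> = (\<integral>\<^sup>+t. ennreal (indicator {0<..} t * bessel_kernel p 0 t) \<partial>lborel)"
    by (rule nn_integral_cong)
      (auto simp: indicator_def bessel_kernel_def exp_minus field_simps less_le)
  finally have "has_bochner_integral lborel (\<lambda>t. indicator {0<..} t * bessel_kernel p 0 t) (Gamma p)"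
    by (intro has_bochner_integral_nn_integral)
      (auto simp: bessel_kernel_nonneg indicator_def Gamma_real_nonneg assms less_imp_le)
  then show "set_integrable lborel {0<..} (bessel_kernel p 0)" "bessel_K p 0 = Gamma p"
    by (auto simp: has_bochner_integral_iff set_integrable_def bessel_K_def set_lebesgue_integral_def)
qed

lemma power_le_fact_mult_exp:
  assumes "0 \<le> (x :: real)" shows "x ^ n \<le> fact n * exp x"
proof -
  have "(\<Sum>k\<in>{n}. x ^ k /\<^sub>R fact k) \<le> (\<Sum>k. x ^ k /\<^sub>R fact k)"
    by (rule sum_le_suminf[OF sums_summable[OF exp_converges]]) (use assms in auto)
  also have "\<dots> = exp x" using exp_converges by (rule sums_unique[symmetric])
  finally show ?thesis by (simp add: field_simps)
qed

text \<open>
  With \<open>x = z/(4t)\<close> the factor \<open>z\<^sup>n\<close> equals \<open>(4t)\<^sup>n x\<^sup>n\<close>, and \<open>x\<^sup>n exp (- x) \<le> n!\<close>. Thus each power of \<open>z\<close>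
  is traded for a power of \<open>t\<close>, which raises the index until the Gamma integral converges at \<open>0\<close>.
\<close>

lemma bessel_kernel_bound:
  assumes "0 \<le> z" "0 < t"
  shows "z ^ n * bessel_kernel p z t \<le> fact n * 4 ^ n * bessel_kernel (p + real n) 0 t"
proof -
  let ?x = "z / (4 * t)"
  have "?x ^ n * exp (- ?x) \<le> fact n"
    using power_le_fact_mult_exp[of ?x n] assms by (simp add: exp_minus field_simps)
  then have le: "(4 * t) ^ n * (?x ^ n * exp (- ?x)) * (exp (- t) * t powr (p - 1))
      \<le> (4 * t) ^ n * fact n * (exp (- t) * t powr (p - 1))"
    using assms by (intro mult_left_mono mult_right_mono) auto
  have z: "(4 * t) ^ n * ?x ^ n = z ^ n"
    using assms by (subst power_mult_distrib[symmetric]) simp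
  have t: "t ^ n * t powr (p - 1) = t powr (p + real n - 1)"
    using assms by (simp add: powr_realpow[symmetric] powr_add[symmetric] algebra_simps)
  have e: "exp (- t - ?x) = exp (- t) * exp (- ?x)" by (simp add: mult_exp_exp)
  have "z ^ n * bessel_kernel p z t = (4 * t) ^ n * (?x ^ n * exp (- ?x)) * (exp (- t) * t powr (p - 1))"
    unfolding bessel_kernel_def e z[symmetric] by (simp only: mult_ac)
  also have "\<dots> \<le> (4 * t) ^ n * fact n * (exp (- t) * t powr (p - 1))" by (rule le)
  also have "\<dots> = fact n * 4 ^ n * bessel_kernel (p + real n) 0 t"
    by (simp add: bessel_kernel_def t[symmetric] power_mult_distrib)
  finally show ?thesis .
qed

lemma bessel_kernel_integrable:
  assumes "0 < z \<or> (0 \<le> z \<and> 0 < p)"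
  shows "set_integrable lborel {0<..} (bessel_kernel p z)"
proof -
  obtain n where n: "0 < p + real n" "0 < z ^ n" "0 \<le> z"
  proof (cases "0 < z")
    case True
    obtain n where "- p < real n" using reals_Archimedean2 by blast
    then show thesis using True by (intro that[of n]) auto
  next
    case False then show thesis using assms by (intro that[of 0]) auto
  qed
  have i: "integrable lborel (\<lambda>t. fact n * 4 ^ n / z ^ n * (indicator {0<..} t *\<^sub>R bessel_kernel (p + real n) 0 t))"
    using bessel_kernel_0_integrable[OF n(1)] by (simp add: set_integrable_def)
  show ?thesis
    unfolding set_integrable_def
  proof (rule Bochner_Integration.integrable_bound[OF i])
    have "bessel_kernel p z t \<le> fact n * 4 ^ n / z ^ n * bessel_kernel (p + real n) 0 t" if "0 < t" for t
      using bessel_kernel_bound[OF n(3) that, of n p] n(2) by (simp add: field_simps)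
    then show "AE t in lborel. norm (indicator {0<..} t *\<^sub>R bessel_kernel p z t)
        \<le> norm (fact n * 4 ^ n / z ^ n * (indicator {0<..} t *\<^sub>R bessel_kernel (p + real n) 0 t))"
      using n by (auto simp: indicator_def abs_mult bessel_kernel_nonneg)
  qed simp
qed

lemma bessel_K_bound:
  assumes "0 < z \<or> (0 \<le> z \<and> 0 < p)" "0 < p + real n"
  shows "z ^ n * bessel_K p z \<le> fact n * 4 ^ n * Gamma (p + real n)"
proof -
  have z: "0 \<le> z" using assms by auto
  have "z ^ n * bessel_K p z = (LINT t:{0<..}|lborel. z ^ n * bessel_kernel p z t)"
    by (simp add: bessel_K_def)
  also have "\<dots> \<le> (LINT t:{0<..}|lborel. fact n * 4 ^ n * bessel_kernel (p + real n) 0 t)"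
    using bessel_kernel_integrable[OF assms(1)] bessel_kernel_0_integrable[OF assms(2)]
    by (intro set_integral_mono) (auto simp: bessel_kernel_bound z)
  also have "\<dots> = fact n * 4 ^ n * Gamma (p + real n)"
    using bessel_K_0[OF assms(2)] by (simp add: bessel_K_def)
  finally show ?thesis .
qed

lemma bessel_K_le_Gamma: "0 \<le> z \<Longrightarrow> 0 < p \<Longrightarrow> bessel_K p z \<le> Gamma p"
  using bessel_K_bound[of z p 0] by simp

lemma bessel_K_tendsto_Gamma:
  assumes "0 < p" and X: "X \<longlonglongrightarrow> 0" and X0: "\<And>n. 0 \<le> X n"
  shows "(\<lambda>n. bessel_K p (X n)) \<longlonglongrightarrow> Gamma p"
proof -
  have "(\<lambda>n. bessel_K p (X n)) \<longlonglongrightarrow> bessel_K p 0"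
    unfolding bessel_K_def set_lebesgue_integral_def
  proof (rule integral_dominated_convergence)
    show "integrable lborel (\<lambda>t. indicator {0<..} t *\<^sub>R bessel_kernel p 0 t)"
      using bessel_kernel_0_integrable[OF assms(1)] by (simp add: set_integrable_def)
    show "AE t in lborel. (\<lambda>n. indicator {0<..} t *\<^sub>R bessel_kernel p (X n) t)
        \<longlonglongrightarrow> indicator {0<..} t *\<^sub>R bessel_kernel p 0 t"
    proof (rule AE_I2)
      fix t :: real
      have "(\<lambda>n. X n / (4 * t)) \<longlonglongrightarrow> 0" using tendsto_mult_left_zero[OF X, of "1 / (4 * t)"] by simp
      then have "(\<lambda>n. indicator {0<..} t *\<^sub>R (exp (- t - X n / (4 * t)) * t powr (p - 1)))
        \<longlonglongrightarrow> indicator {0<..} t *\<^sub>R (exp (- t - 0) * t powr (p - 1))"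
        by (intro tendsto_intros)
      then show "(\<lambda>n. indicator {0<..} t *\<^sub>R bessel_kernel p (X n) t)
          \<longlonglongrightarrow> indicator {0<..} t *\<^sub>R bessel_kernel p 0 t"
        by (simp add: bessel_kernel_def)
    qed
    show "AE t in lborel. norm (indicator {0<..} t *\<^sub>R bessel_kernel p (X n) t)
        \<le> indicator {0<..} t *\<^sub>R bessel_kernel p 0 t" for n
      using bessel_kernel_bound[where z = "X n" and n = 0 and p = p, OF X0] by (auto simp: indicator_def bessel_kernel_nonneg)
  qed simp_all
  then show ?thesis using bessel_K_0[OF assms(1)] by simp
qed

lemma bessel_K_has_derivative:
  assumes "0 < z"
  shows "(bessel_K p has_real_derivative - (1 / 4) * bessel_K (p - 1) z) (at z)"
proof -
  let ?F' = "\<lambda>z t. indicator {0<..} t * (- (1 / 4) * bessel_kernel (p - 1) z t)"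
  have "((\<lambda>z. LINT t|lborel. indicator {0<..} t * bessel_kernel p z t)
      has_real_derivative (LINT t|lborel. ?F' z t)) (at z)"
  proof (rule has_derivative_under_integral[where a = "z / 2" and b = "2 * z"
        and w = "\<lambda>t. indicator {0<..} t * bessel_kernel (p - 1) (z / 2) t"])
    show "z \<in> {z / 2<..<2 * z}" using assms by simp
    show "integrable lborel (\<lambda>t. indicator {0<..} t * bessel_kernel p y t)" if "y \<in> {z / 2<..<2 * z}" for y
      using bessel_kernel_integrable[of y p] that assms by (simp add: set_integrable_def)
    show "integrable lborel (\<lambda>t. indicator {0<..} t * bessel_kernel (p - 1) (z / 2) t)"
      using bessel_kernel_integrable[of "z / 2" "p - 1"] assms by (simp add: set_integrable_def)
    fix y t :: real assume y: "y \<in> {z / 2<..<2 * z}"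
    show "((\<lambda>y. indicator {0<..} t * bessel_kernel p y t) has_real_derivative ?F' y t) (at y)"
    proof (cases "0 < t")
      case True
      have "((\<lambda>y. exp (- t - y / (4 * t)) * t powr (p - 1)) has_real_derivative
          exp (- t - y / (4 * t)) * (- (1 / (4 * t))) * t powr (p - 1)) (at y)"
        using True by (auto intro!: derivative_eq_intros)
      moreover have "t powr (p - 1 - 1) = t powr (p - 1) / t"
        using True powr_diff[of t "p - 1" 1] by simp
      ultimately show ?thesis using True by (simp add: bessel_kernel_def)
    qed simp
    show "\<bar>?F' y t\<bar> \<le> indicator {0<..} t * bessel_kernel (p - 1) (z / 2) t"
    proof (cases "0 < t")
      case True
      have "bessel_kernel (p - 1) y t \<le> bessel_kernel (p - 1) (z / 2) t"
        unfolding bessel_kernel_def using True y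
        by (intro mult_right_mono) (auto simp: field_simps)
      moreover have "0 \<le> bessel_kernel (p - 1) y t" by (rule bessel_kernel_nonneg)
      ultimately show ?thesis using True by (simp add: abs_mult)
    qed simp
  qed simp
  moreover have "(LINT t|lborel. ?F' z t) = - (1 / 4) * bessel_K (p - 1) z"
  proof -
    have "(LINT t|lborel. ?F' z t) = (LINT t|lborel. - (1 / 4) * (indicator {0<..} t * bessel_kernel (p - 1) z t))"
      by (simp add: mult_ac)
    then show ?thesis by (simp add: bessel_K_def set_lebesgue_integral_def)
  qed
  ultimately show ?thesis by (simp add: bessel_K_def[abs_def] set_lebesgue_integral_def)
qed

lemma
  assumes "0 < l" "0 < b"
  shows scaled_kernel_integrable:
      "set_integrable lborel {0<..} (\<lambda>t. exp (- (t * l)) * (exp (- b / t) * t powr (p - 1)))"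
    and scaled_kernel_integral:
      "(LINT t:{0<..}|lborel. exp (- (t * l)) * (exp (- b / t) * t powr (p - 1)))
        = l powr (- p) * bessel_K p (4 * b * l)"
proof -
  have i: "set_integrable lborel {0<..} (bessel_kernel p (4 * b * l))"
    using assms by (intro bessel_kernel_integrable) simp
  have im: "(\<lambda>t. l * t) ` {0<..} = {0<..}"
  proof (intro equalityI subsetI)
    fix x :: real assume "x \<in> {0<..}"
    then show "x \<in> (\<lambda>t. l * t) ` {0<..}" using assms by (intro image_eqI[of _ _ "x / l"]) auto
  qed (use assms in auto)
  have inj: "inj_on (\<lambda>t. l * t) {0<..}" using assms by (simp add: inj_on_def)
  have d: "((\<lambda>t. l * t) has_real_derivative l) (at x)" for x
    by (auto intro!: derivative_eq_intros)
  note c = lborel_change_of_variables_pos[OF _ _ _ d inj im i]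
  have e: "exp (- (t * l)) * (exp (- b / t) * t powr (p - 1))
      = l powr (- p) * (\<bar>l\<bar> * bessel_kernel p (4 * b * l) (l * t))" if "0 < t" for t
  proof -
    have "l powr (- p) * (l * (l * t) powr (p - 1)) = t powr (p - 1)"
      using assms that by (simp add: powr_mult powr_diff powr_minus field_simps)
    moreover have "exp (- (l * t) - 4 * b * l / (4 * (l * t))) = exp (- (t * l)) * exp (- b / t)"
      using assms that by (simp add: mult_exp_exp field_simps)
    ultimately show ?thesis using assms by (simp add: bessel_kernel_def mult_ac)
  qed
  have "set_integrable lborel {0<..} (\<lambda>t. l powr (- p) * (\<bar>l\<bar> * bessel_kernel p (4 * b * l) (l * t)))"
    using c(1) by (intro set_integrable_mult_right) simp
  then show "set_integrable lborel {0<..} (\<lambda>t. exp (- (t * l)) * (exp (- b / t) * t powr (p - 1)))"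
    using e by (subst set_integrable_cong[OF refl refl]) auto
  have "(LINT t:{0<..}|lborel. exp (- (t * l)) * (exp (- b / t) * t powr (p - 1)))
      = (LINT t:{0<..}|lborel. l powr (- p) * (\<bar>l\<bar> * bessel_kernel p (4 * b * l) (l * t)))"
    using e by (intro set_lebesgue_integral_cong) auto
  also have "\<dots> = l powr (- p) * bessel_K p (4 * b * l)"
    using c(2) by (simp add: bessel_K_def)
  finally show "(LINT t:{0<..}|lborel. exp (- (t * l)) * (exp (- b / t) * t powr (p - 1)))
        = l powr (- p) * bessel_K p (4 * b * l)" .
qed

text \<open>
  The exponent \<open>t + z/(4t)\<close> is invariant under \<open>t \<mapsto> z/(4t)\<close>.
\<close>

lemma bessel_K_reflection:
  assumes "0 < z"
  shows "bessel_K p z = (z / 4) powr p * bessel_K (- p) z"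
proof -
  have i: "set_integrable lborel {0<..} (bessel_kernel (- p) z)"
    using assms by (intro bessel_kernel_integrable) simp
  have im: "(\<lambda>t. z / 4 / t) ` {0<..} = {0<..}"
  proof (intro equalityI subsetI)
    fix x :: real assume "x \<in> {0<..}"
    then show "x \<in> (\<lambda>t. z / 4 / t) ` {0<..}" using assms by (intro image_eqI[of _ _ "z / 4 / x"]) auto
  qed (use assms in auto)
  have inj: "inj_on (\<lambda>t. z / 4 / t) {0<..}" using assms by (auto simp: inj_on_def)
  have d: "((\<lambda>t. z / 4 / t) has_real_derivative - (z / 4 / t ^ 2)) (at t)" if "0 < t" for t
    using that by (auto intro!: derivative_eq_intros simp: power2_eq_square)
  note c = lborel_change_of_variables_pos(2)[OF _ _ _ d inj im i]
  have e: "bessel_kernel p z t = (z / 4) powr p * (\<bar>- (z / 4 / t ^ 2)\<bar> * bessel_kernel (- p) z (z / 4 / t))"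
    if t: "0 < t" for t
  proof -
    have "exp (- (z / 4 / t) - z / (4 * (z / 4 / t))) = exp (- t - z / (4 * t))"
      using t assms by (simp add: field_simps)
    moreover have "(z / 4) powr p * (z / 4 / t ^ 2 * (z / 4 / t) powr (- p - 1)) = t powr (p - 1)"
      using t assms
      by (simp add: powr_divide powr_mult powr_diff powr_minus field_simps power2_eq_square)
    moreover have "\<bar>- (z / 4 / t ^ 2)\<bar> = z / 4 / t ^ 2" using assms by simp
    ultimately show ?thesis unfolding bessel_kernel_def by (metis mult.left_commute mult.commute)
  qed
  have "bessel_K p z = (LINT t:{0<..}|lborel. (z / 4) powr p * (\<bar>- (z / 4 / t ^ 2)\<bar> * bessel_kernel (- p) z (z / 4 / t)))"
    unfolding bessel_K_def by (rule set_lebesgue_integral_cong) (auto simp: e)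
  also have "\<dots> = (z / 4) powr p * bessel_K (- p) z"
    unfolding bessel_K_def set_integral_mult_right by (subst c) simp_all
  finally show ?thesis .
qed

text \<open>
  Both sides of the reflection formula are differentiated: the left one gives
  \<open>- K\<^sub>p\<^sub>-\<^sub>1 / 4\<close>, and the right one is expressed by \<open>K\<^sub>p\<close> and \<open>K\<^sub>p\<^sub>+\<^sub>1\<close> by applying the reflection formula
  once more.
\<close>

lemma bessel_K_recurrence:
  assumes z: "0 < z"
  shows "bessel_K (p + 1) z = p * bessel_K p z + z / 4 * bessel_K (p - 1) z"
proof -
  have "((\<lambda>z. (z / 4) powr p * bessel_K (- p) z) has_real_derivative
      (p * (z / 4) powr (p - 1) * (1 / 4)) * bessel_K (- p) z
        + (- (1 / 4) * bessel_K (- p - 1) z) * (z / 4) powr p) (at z)"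
    using z bessel_K_has_derivative[OF z, of "- p"]
    by (intro DERIV_mult) (auto intro!: derivative_eq_intros simp: powr_diff)
  then have "(bessel_K p has_real_derivative
      (p * (z / 4) powr (p - 1) * (1 / 4)) * bessel_K (- p) z
        + (- (1 / 4) * bessel_K (- p - 1) z) * (z / 4) powr p) (at z)"
    by (rule has_field_derivative_transform_within_open[where S = "{0<..}"])
      (use z in \<open>auto simp: bessel_K_reflection[of _ p]\<close>)
  from DERIV_unique[OF bessel_K_has_derivative[OF z] this]
  have "- (1 / 4) * bessel_K (p - 1) z = (p * (z / 4) powr (p - 1) * (1 / 4)) * bessel_K (- p) z
        + (- (1 / 4) * bessel_K (- p - 1) z) * (z / 4) powr p" .
  moreover have "bessel_K (- p) z = (z / 4) powr (- p) * bessel_K p z"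
    using bessel_K_reflection[OF z, of "- p"] by simp
  moreover have "bessel_K (- p - 1) z = (z / 4) powr (- p - 1) * bessel_K (p + 1) z"
    using bessel_K_reflection[OF z, of "- p - 1"] by (simp add: add.commute)
  moreover have "(z / 4) powr (p - 1) * (z / 4) powr (- p) = 4 / z"
    "(z / 4) powr (- p - 1) * (z / 4) powr p = 4 / z"
    using z powr_add[of "z / 4" "p - 1" "- p"] powr_add[of "z / 4" "- p - 1" p]
    by (simp_all add: powr_minus_divide)
  ultimately have "- (1 / 4) * bessel_K (p - 1) z = p * (1 / 4) * (4 / z) * bessel_K p z
      - (1 / 4) * (4 / z) * bessel_K (p + 1) z"
    by (smt (verit) mult.assoc mult.commute mult_minus_left)
  then show ?thesis using z by (simp add: field_simps)
qed

section \<open>Weak integrals of the heat semigroup\<close>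

context projection_valued_measure begin

text \<open>
  The resolution is carried by \<open>[0,\<infinity>)\<close>, which makes the exponentials \<open>exp (- t \<lambda>)\<close> bounded on the
  spectrum.
\<close>

lemma AE_spec_nonneg:
  assumes u: "u \<in> L2 M" shows "AE l in spec u. 0 \<le> l"
proof -
  have "ip M (Q ({..<0} \<union> {0..}) u) u = ip M (Q {..<0} u) u + ip M (Q {0..} u) u"
    by (rule ip_proj_Un) (use u in auto)
  moreover have "{..<0} \<union> {0..} = (UNIV :: real set)" by auto
  moreover have "ip M (Q {0..} u) u = ip M u u"
    using resolution u unfolding resolution_of_identity_def by (intro ip_cong_AE) auto
  ultimately have "emeasure (spec u) {..<0} = 0"
    using ip_proj_UNIV[OF u u] by (simp add: emeasure_spec[OF u])
  then have "{..<0} \<in> null_sets (spec u)" by (auto simp: null_sets_def)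
  then show ?thesis by (rule AE_I') auto
qed

lemma L2_spec_bounded_mult:
  assumes u: "u \<in> L2 M" and \<phi>: "\<phi> \<in> L2 (spec u)" and \<psi>: "\<psi> \<in> borel_measurable borel"
    and bd: "\<And>l. 0 \<le> l \<Longrightarrow> \<bar>\<psi> l\<bar> \<le> C"
  shows "(\<lambda>l. \<psi> l * \<phi> l) \<in> L2 (spec u)"
proof -
  have [measurable]: "\<phi> \<in> borel_measurable (spec u)" "\<psi> \<in> borel_measurable (spec u)"
    using \<phi> \<psi> by (auto simp: L2_def)
  have i: "integrable (spec u) (\<lambda>l. C\<^sup>2 * (\<phi> l)\<^sup>2)" using \<phi> by (simp add: L2_def)
  have "integrable (spec u) (\<lambda>l. (\<psi> l * \<phi> l)\<^sup>2)"
  proof (rule Bochner_Integration.integrable_bound[OF i])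
    show "AE l in spec u. norm ((\<psi> l * \<phi> l)\<^sup>2) \<le> norm (C\<^sup>2 * (\<phi> l)\<^sup>2)"
      using AE_spec_nonneg[OF u]
    proof eventually_elim
      case (elim l)
      have "(\<psi> l)\<^sup>2 \<le> C\<^sup>2" using bd[OF elim] by (metis abs_ge_zero power2_abs power_mono)
      then show ?case by (simp add: power_mult_distrib mult_right_mono)
    qed
  qed simp
  then show ?thesis by (simp add: L2_def)
qed

lemma heat_represents:
  assumes u: "u \<in> L2 M" and w: "represents \<phi> u w" and t: "0 \<le> t"
  shows "represents (\<lambda>l. exp (- (t * l)) * \<phi> l) u (heat M Q t w)"
  unfolding heat_def
  by (rule spectral_op_represents[OF u w])
    (use t in \<open>auto intro!: L2_spec_bounded_mult[OF u representsD(1)[OF w], where C = 1]\<close>)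

text \<open>
  After pairing with \<open>g\<close>, the integral over \<open>t\<close> of \<open>\<integral> exp (- t \<lambda>) \<phi> h dm\<close> is a double integral to which
  Fubini's theorem applies. Its absolute convergence follows from that of \<open>\<integral> \<theta> h dm\<close>, since the weight
  \<open>exp (- t \<lambda>) k t\<close> is nonnegative. At points where \<open>\<phi>\<close> vanishes the inner integral may diverge; this
  happens at \<open>\<lambda> = 0\<close> in the definition of the extension.
\<close>

lemma has_weak_integral_heat:
  assumes u: "u \<in> L2 M" and w: "represents \<phi> u w"
    and [measurable]: "k \<in> borel_measurable borel" and k0: "\<And>t. 0 < t \<Longrightarrow> 0 \<le> k t"
    and int: "AE l in spec u. \<phi> l = 0 \<or> set_integrable lborel {0<..} (\<lambda>t. exp (- (t * l)) * k t)"
    and v: "represents \<theta> u v"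
    and \<theta>: "AE l in spec u. \<theta> l = c * (\<phi> l * (LINT t:{0<..}|lborel. exp (- (t * l)) * k t))"
    and c: "c \<noteq> 0"
  shows "has_weak_integral M c (\<lambda>t. heat M Q t w) k v"
  unfolding has_weak_integral_def
proof (intro conjI ballI)
  show "v \<in> L2 M" by (rule representsD(2)[OF v])
  fix g assume g: "g \<in> L2 M"
  interpret S: finite_measure "spec u" by (rule finite_measure_spec[OF u])
  interpret pair_sigma_finite "spec u" lborel ..
  let ?H = "pairing_density u g"
  let ?I = "\<lambda>l. LINT t:{0<..}|lborel. exp (- (t * l)) * k t"
  let ?F = "\<lambda>l t. indicator {0<..} t * (exp (- (t * l)) * k t) * (\<phi> l * ?H l)"
  have [measurable]: "\<phi> \<in> borel_measurable (spec u)" "?H \<in> borel_measurable (spec u)"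
    "\<theta> \<in> borel_measurable (spec u)"
    using representsD(1)[OF w] dens_L2[OF u g] representsD(1)[OF v] by (auto simp: L2_def)
  have [measurable]: "?I \<in> borel_measurable (spec u)"
    unfolding set_lebesgue_integral_def by measurable
  have i\<theta>: "integrable (spec u) (\<lambda>l. \<theta> l * ?H l)"
    by (rule L2_integrable_mult[OF representsD(1)[OF v] dens_L2[OF u g]])
  have inner: "AE l in spec u. integrable lborel (?F l) \<and>
      (LINT t|lborel. norm (?F l t)) = norm (1 / c * (\<theta> l * ?H l)) \<and>
      (LINT t|lborel. ?F l t) = 1 / c * (\<theta> l * ?H l)"
    using int \<theta>
  proof eventually_elim
    case (elim l)
    have nn: "0 \<le> ?I l"
      unfolding set_lebesgue_integral_def
      by (rule integral_nonneg_AE) (auto simp: indicator_def k0)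
    show ?case
    proof (cases "\<phi> l = 0")
      case True
      then show ?thesis using elim by simp
    next
      case False
      have i: "integrable lborel (\<lambda>t. indicator {0<..} t * (exp (- (t * l)) * k t))"
        using elim False by (simp add: set_integrable_def)
      have n: "norm (?F l t) = indicator {0<..} t * (exp (- (t * l)) * k t) * norm (\<phi> l * ?H l)" for t
        by (auto simp: indicator_def abs_mult k0)
      have "(LINT t|lborel. indicator {0<..} t * (exp (- (t * l)) * k t)) = ?I l"
        by (simp add: set_lebesgue_integral_def)
      then show ?thesis
        unfolding n using i nn c elim by (simp add: abs_mult)
    qed
  qed
  have iF: "integrable (spec u \<Otimes>\<^sub>M lborel) (case_prod ?F)"
  proof (rule Fubini_integrable)
    show "case_prod ?F \<in> borel_measurable (spec u \<Otimes>\<^sub>M lborel)" by measurable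
    show "AE l in spec u. integrable lborel (\<lambda>t. case_prod ?F (l, t))"
      using inner by eventually_elim simp
    show "integrable (spec u) (\<lambda>l. LINT t|lborel. norm (case_prod ?F (l, t)))"
    proof (rule integrable_cong_AE_imp[of _ "\<lambda>l. norm (1 / c * (\<theta> l * ?H l))"])
      show "integrable (spec u) (\<lambda>l. norm (1 / c * (\<theta> l * ?H l)))"
        using i\<theta> by (intro integrable_norm integrable_mult_right)
      show "AE l in spec u. norm (1 / c * (\<theta> l * ?H l)) = (LINT t|lborel. norm (case_prod ?F (l, t)))"
        using inner by eventually_elim simp
    qed measurable
  qed
  have slice: "(LINT l|spec u. ?F l t) = indicator {0<..} t * (ip M (heat M Q t w) g * k t)" for t
  proof (cases "0 < t")
    case True
    have "(LINT l|spec u. ?F l t) = (LINT l|spec u. k t * (exp (- (t * l)) * \<phi> l * ?H l))"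
      using True by (simp add: mult_ac)
    also have "\<dots> = k t * ip M (heat M Q t w) g"
      using representsD(3)[OF heat_represents[OF u w] g, of t] True by (simp add: ip_def)
    finally show ?thesis using True by simp
  qed simp
  show "set_integrable lborel {0<..} (\<lambda>t. ip M (heat M Q t w) g * k t)"
    using integrable_snd[OF iF] by (simp add: slice set_integrable_def)
  have "(LINT t:{0<..}|lborel. ip M (heat M Q t w) g * k t) = (LINT t|lborel. LINT l|spec u. ?F l t)"
    by (simp add: slice set_lebesgue_integral_def)
  also have "\<dots> = (LINT l|spec u. LINT t|lborel. ?F l t)" by (rule Fubini_integral[OF iF])
  also have "\<dots> = (LINT l|spec u. 1 / c * (\<theta> l * ?H l))"
    by (rule integral_cong_AE) (use inner in \<open>auto\<close>)
  also have "\<dots> = 1 / c * ip M v g"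
    using representsD(3)[OF v g] by (simp add: ip_def)
  finally show "ip M v g = c * (LINT t:{0<..}|lborel. ip M (heat M Q t w) g * k t)"
    using c by simp
qed

end

section \<open>The extension profile on the spectral side\<close>

text \<open>
  The function of \<open>\<lambda>\<close> that represents \<open>U(\<cdot>,y)\<close>, and below its first two derivatives in \<open>y\<close>. The value
  at \<open>\<lambda> = 0\<close> is \<open>0\<close>, because \<open>0\<^sup>s = 0\<close>, although the limit of the profile there is \<open>1\<close>.
\<close>

definition extension_profile :: "real \<Rightarrow> real \<Rightarrow> real \<Rightarrow> real" where
  "extension_profile s y l = indicator {0<..} l * (bessel_K s (y\<^sup>2 * l) / Gamma s)"

definition extension_profile' :: "real \<Rightarrow> real \<Rightarrow> real \<Rightarrow> real" where
  "extension_profile' s y l = indicator {0<..} l * (- (y * l / 2) * bessel_K (s - 1) (y\<^sup>2 * l) / Gamma s)"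

definition extension_profile'' :: "real \<Rightarrow> real \<Rightarrow> real \<Rightarrow> real" where
  "extension_profile'' s y l = indicator {0<..} l *
     ((- (l / 2) * bessel_K (s - 1) (y\<^sup>2 * l) + y\<^sup>2 * l\<^sup>2 / 4 * bessel_K (s - 2) (y\<^sup>2 * l)) / Gamma s)"

lemma extension_profile_measurable [measurable]:
  "extension_profile s y \<in> borel_measurable borel"
  "extension_profile' s y \<in> borel_measurable borel"
  "extension_profile'' s y \<in> borel_measurable borel"
  unfolding extension_profile_def[abs_def] extension_profile'_def[abs_def]
    extension_profile''_def[abs_def] by measurable

lemma extension_profile_bounded:
  assumes "0 < s" "0 < y"
  shows "\<bar>extension_profile s y l\<bar> \<le> 1"
proof (cases "0 < l")
  case True
  have "bessel_K s (y\<^sup>2 * l) \<le> Gamma s" using True assms by (intro bessel_K_le_Gamma) auto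
  moreover have "0 < Gamma s" using assms by (simp add: Gamma_real_pos)
  ultimately show ?thesis using True by (simp add: extension_profile_def bessel_K_nonneg)
qed (simp add: extension_profile_def)

lemma mult_extension_profile_bounded:
  assumes "0 < s" "0 < y"
  shows "\<bar>l * extension_profile s y l\<bar> \<le> 4 * s / y\<^sup>2"
proof (cases "0 < l")
  case True
  have G: "0 < Gamma s" using assms by (simp add: Gamma_real_pos)
  have "y\<^sup>2 * l * bessel_K s (y\<^sup>2 * l) \<le> 4 * Gamma (s + 1)"
    using bessel_K_bound[of "y\<^sup>2 * l" s 1] True assms by simp
  also have "Gamma (s + 1) = s * Gamma s"
    using assms by (intro Gamma_plus1) (auto elim!: nonpos_Ints_cases)
  finally have "l * (bessel_K s (y\<^sup>2 * l) / Gamma s) \<le> 4 * s / y\<^sup>2"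
    using assms G by (simp add: field_simps)
  then show ?thesis using True G by (simp add: extension_profile_def bessel_K_nonneg abs_mult)
qed (use assms in \<open>simp add: extension_profile_def\<close>)

lemma extension_profile'_bounded:
  assumes "0 < s" "0 < y"
  shows "\<bar>extension_profile' s y l\<bar> \<le> 2 / y"
proof (cases "0 < l")
  case True
  have G: "0 < Gamma s" using assms by (simp add: Gamma_real_pos)
  have "y\<^sup>2 * l * bessel_K (s - 1) (y\<^sup>2 * l) \<le> 4 * Gamma s"
    using bessel_K_bound[of "y\<^sup>2 * l" "s - 1" 1] True assms by simp
  then have "y * l / 2 * bessel_K (s - 1) (y\<^sup>2 * l) / Gamma s \<le> 2 / y"
    using assms G by (simp add: field_simps power2_eq_square)
  then show ?thesis using True G assms
    by (simp add: extension_profile'_def bessel_K_nonneg abs_mult)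
qed (use assms in \<open>simp add: extension_profile'_def\<close>)

lemma extension_profile''_bounded:
  assumes "0 < s" "0 < y"
  shows "\<bar>extension_profile'' s y l\<bar> \<le> 10 / y\<^sup>2"
proof (cases "0 < l")
  case True
  let ?z = "y\<^sup>2 * l"
  have G: "0 < Gamma s" using assms by (simp add: Gamma_real_pos)
  have "?z * bessel_K (s - 1) ?z \<le> 4 * Gamma s"
    using bessel_K_bound[of ?z "s - 1" 1] True assms by simp
  then have 1: "y\<^sup>2 * (l / 2 * bessel_K (s - 1) ?z) \<le> 2 * Gamma s" by (simp add: mult_ac)
  have "?z\<^sup>2 * bessel_K (s - 2) ?z \<le> 32 * Gamma s"
    using bessel_K_bound[of ?z "s - 2" 2] True assms by simp
  then have 2: "y\<^sup>2 * (y\<^sup>2 * l\<^sup>2 / 4 * bessel_K (s - 2) ?z) \<le> 8 * Gamma s"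
    by (simp add: power_mult_distrib power2_eq_square mult_ac)
  let ?A = "l / 2 * bessel_K (s - 1) ?z" and ?B = "y\<^sup>2 * l\<^sup>2 / 4 * bessel_K (s - 2) ?z"
  have "0 \<le> ?A" "0 \<le> ?B" using True by (auto simp: bessel_K_nonneg)
  then have "\<bar>- ?A + ?B\<bar> \<le> ?A + ?B" by linarith
  moreover have "?A + ?B \<le> 10 * Gamma s / y\<^sup>2"
  proof -
    have "y\<^sup>2 * (?A + ?B) \<le> 10 * Gamma s" unfolding distrib_left using 1 2 by linarith
    moreover have "0 < y\<^sup>2" using assms by simp
    ultimately show ?thesis by (simp only: pos_le_divide_eq mult.commute)
  qed
  ultimately have "\<bar>- ?A + ?B\<bar> / Gamma s \<le> (10 * Gamma s / y\<^sup>2) / Gamma s"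
    using G by (intro divide_right_mono) linarith+
  then show ?thesis using True G assms by (simp add: extension_profile''_def)
qed (use assms in \<open>simp add: extension_profile''_def\<close>)

lemma extension_profile_has_derivative:
  assumes "0 < y"
  shows "((\<lambda>y. extension_profile s y l) has_real_derivative extension_profile' s y l) (at y)"
proof (cases "0 < l")
  case True
  have z: "0 < y\<^sup>2 * l" using True assms by simp
  have "((\<lambda>y. bessel_K s (y\<^sup>2 * l)) has_real_derivative (- (1 / 4) * bessel_K (s - 1) (y\<^sup>2 * l)) * (2 * y * l)) (at y)"
    by (rule DERIV_chain2[where f = "bessel_K s" and g = "\<lambda>y. y\<^sup>2 * l", OF bessel_K_has_derivative[OF z]])
      (auto intro!: derivative_eq_intros)
  from DERIV_cdivide[OF this, of "Gamma s"] show ?thesis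
    using True by (simp add: extension_profile_def extension_profile'_def mult_ac)
qed (simp add: extension_profile_def extension_profile'_def)

lemma extension_profile'_has_derivative:
  assumes "0 < y"
  shows "((\<lambda>y. extension_profile' s y l) has_real_derivative extension_profile'' s y l) (at y)"
proof (cases "0 < l")
  case True
  have z: "0 < y\<^sup>2 * l" using True assms by simp
  have K: "((\<lambda>y. bessel_K (s - 1) (y\<^sup>2 * l)) has_real_derivative (- (1 / 4) * bessel_K (s - 1 - 1) (y\<^sup>2 * l)) * (2 * y * l)) (at y)"
    by (rule DERIV_chain2[where f = "bessel_K (s - 1)" and g = "\<lambda>y. y\<^sup>2 * l",
          OF bessel_K_has_derivative[OF z]])
      (auto intro!: derivative_eq_intros)
  have "((\<lambda>y. - (y * l / 2)) has_real_derivative - (l / 2)) (at y)"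
    by (auto intro!: derivative_eq_intros)
  from DERIV_cdivide[OF DERIV_mult[OF this K], of "Gamma s"]
  show ?thesis
    using True by (simp add: extension_profile'_def extension_profile''_def power2_eq_square algebra_simps)
qed (simp add: extension_profile'_def extension_profile''_def)

text \<open>
  For fixed \<open>\<lambda>\<close> this is the recurrence of \<^const>\<open>bessel_K\<close> at index \<open>s - 1\<close> and argument \<open>y\<^sup>2 \<lambda>\<close>.
\<close>

lemma extension_profile_ODE:
  assumes "0 < y"
  shows "extension_profile'' s y l + (1 - 2 * s) / y * extension_profile' s y l = l * extension_profile s y l"
proof (cases "0 < l")
  case True
  let ?z = "y\<^sup>2 * l"
  have rec: "bessel_K s ?z = (s - 1) * bessel_K (s - 1) ?z + ?z / 4 * bessel_K (s - 2) ?z"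
    using bessel_K_recurrence[of ?z "s - 1"] True assms by simp
  have c: "(1 - 2 * s) / y * (- (y * l / 2) * bessel_K (s - 1) ?z) = - ((1 - 2 * s) * (l / 2) * bessel_K (s - 1) ?z)"
    using assms by simp
  have num: "(- (l / 2) * bessel_K (s - 1) ?z + y\<^sup>2 * l\<^sup>2 / 4 * bessel_K (s - 2) ?z)
      + (1 - 2 * s) / y * (- (y * l / 2) * bessel_K (s - 1) ?z) = l * bessel_K s ?z"
    unfolding c rec by (simp add: power2_eq_square field_simps)
  have div: "A / G + c * (B / G) = l * (K / G)" if "A + c * B = l * K" for A B c K G :: real
    using that by (metis add_divide_distrib times_divide_eq_right)
  have i: "indicator {0<..} l = (1 :: real)" using True by simp
  show ?thesis
    unfolding extension_profile_def extension_profile'_def extension_profile''_def i mult_1_left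
    by (rule div[OF num])
qed (simp add: extension_profile_def extension_profile'_def extension_profile''_def)

text \<open>
  Reflection turns the index \<open>s - 1\<close>, for which the integral diverges as its argument tends to 0, into
  \<open>1 - s\<close>, for which it tends to \<open>\<Gamma>(1 - s)\<close>; the powers of \<open>y\<close> cancel.
\<close>

lemma extension_profile'_weighted:
  assumes "0 < y"
  shows "y powr (1 - 2 * s) * extension_profile' s y l
    = - (2 powr (1 - 2 * s) / Gamma s) * (indicator {0<..} l * (l powr s * bessel_K (1 - s) (y\<^sup>2 * l)))"
proof (cases "0 < l")
  case True
  have K: "bessel_K (s - 1) (y\<^sup>2 * l) = (y\<^sup>2 * l / 4) powr (s - 1) * bessel_K (1 - s) (y\<^sup>2 * l)"
    using bessel_K_reflection[of "y\<^sup>2 * l" "s - 1"] True assms by simp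
  have "y powr (1 - 2 * s) * (y * l / 2) * (y\<^sup>2 * l / 4) powr (s - 1) = 2 powr (1 - 2 * s) * l powr s"
  proof -
    have e: "(y\<^sup>2 * l / 4) powr (s - 1) = y powr (2 * (s - 1)) * l powr (s - 1) / 2 powr (2 * (s - 1))"
      using True assms powr_powr[of y 2 "s - 1"] powr_powr[of 2 2 "s - 1"]
      by (simp add: powr_divide powr_mult)
    have y: "y powr (1 - 2 * s) * y * y powr (2 * (s - 1)) = 1"
      using assms powr_add[of y "1 - 2 * s" 1] powr_add[of y "1 - 2 * s + 1" "2 * (s - 1)"] by simp
    have l: "l * l powr (s - 1) = l powr s"
      using True powr_add[of l 1 "s - 1"] by simp
    have two: "1 / (2 * 2 powr (2 * (s - 1))) = (2 :: real) powr (1 - 2 * s)"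
      using powr_add[of 2 1 "2 * (s - 1)"] powr_minus_divide[of 2 "2 * s - 1"] by (simp add: algebra_simps)
    have "P * (y * l / 2) * (R * S / T) = (P * y * R) * (l * S) * (1 / (2 * T))" for P R S T :: real
      by simp
    then show ?thesis unfolding e by (simp only: y l two mult_1_left) (simp only: mult.commute)
  qed
  then show ?thesis
    using True by (simp add: extension_profile'_def K) (simp add: mult.assoc[symmetric])
qed (simp add: extension_profile'_def)

section \<open>The extension and its limits\<close>

context projection_valued_measure begin

lemma integrable_mult_dens:
  assumes u: "u \<in> L2 M" and g: "g \<in> L2 M" and "\<phi> \<in> borel_measurable borel" "\<And>l. \<bar>\<phi> l\<bar> \<le> C"
  shows "integrable (spec u) (\<lambda>l. \<phi> l * pairing_density u g l)"
  by (rule L2_integrable_mult[OF bounded_L2_spec[OF u assms(3,4)] dens_L2[OF u g]])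

lemma dens_measurable [measurable]:
  "u \<in> L2 M \<Longrightarrow> g \<in> L2 M \<Longrightarrow> pairing_density u g \<in> borel_measurable borel"
  using dens_L2[of u g] by (auto simp: L2_def)

text \<open>
  The bounds on the derivatives of the profile do not depend on \<open>\<lambda>\<close> and are uniform for parameters
  between \<open>y/2\<close> and \<open>2y\<close>, so a multiple of the integrable density is a majorant.
\<close>

lemma
  assumes u: "u \<in> L2 M" and g: "g \<in> L2 M" and s: "0 < s" and y: "0 < y"
  shows extension_pairing_has_derivative:
      "((\<lambda>y. LINT l|spec u. extension_profile s y l * pairing_density u g l) has_real_derivative
        (LINT l|spec u. extension_profile' s y l * pairing_density u g l)) (at y)"
    and extension_pairing_has_second_derivative:
      "((\<lambda>y. LINT l|spec u. extension_profile' s y l * pairing_density u g l) has_real_derivative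
        (LINT l|spec u. extension_profile'' s y l * pairing_density u g l)) (at y)"
proof -
  note [measurable] = dens_measurable[OF u g]
  have y0: "y \<in> {y / 2<..<2 * y}" using y by simp
  have iH: "integrable (spec u) (\<lambda>l. c * \<bar>pairing_density u g l\<bar>)" for c
    using L2_spec_integrable[OF u dens_L2[OF u g]] by simp
  have pos: "0 < x" if "x \<in> {y / 2<..<2 * y}" for x using that y by auto
  show "((\<lambda>y. LINT l|spec u. extension_profile s y l * pairing_density u g l) has_real_derivative
        (LINT l|spec u. extension_profile' s y l * pairing_density u g l)) (at y)"
  proof (rule has_derivative_under_integral[OF y0, where w = "\<lambda>l. 4 / y * \<bar>pairing_density u g l\<bar>"])
    show "integrable (spec u) (\<lambda>l. 4 / y * \<bar>pairing_density u g l\<bar>)" by (rule iH)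
    fix x assume x: "x \<in> {y / 2<..<2 * y}"
    show "integrable (spec u) (\<lambda>l. extension_profile s x l * pairing_density u g l)"
      by (rule integrable_mult_dens[OF u g _ extension_profile_bounded[OF s pos[OF x]]]) simp
    fix l
    show "((\<lambda>y. extension_profile s y l * pairing_density u g l) has_real_derivative extension_profile' s x l * pairing_density u g l) (at x)"
      by (rule DERIV_cmult_right[OF extension_profile_has_derivative[OF pos[OF x]]])
    have "2 / x \<le> 4 / y" using x y pos[OF x] by (simp add: field_simps)
    then have "\<bar>extension_profile' s x l\<bar> \<le> 4 / y"
      using extension_profile'_bounded[OF s pos[OF x], of l] by linarith
    then show "\<bar>extension_profile' s x l * pairing_density u g l\<bar> \<le> 4 / y * \<bar>pairing_density u g l\<bar>"
      unfolding abs_mult by (rule mult_right_mono) simp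
  qed simp
  show "((\<lambda>y. LINT l|spec u. extension_profile' s y l * pairing_density u g l) has_real_derivative
        (LINT l|spec u. extension_profile'' s y l * pairing_density u g l)) (at y)"
  proof (rule has_derivative_under_integral[OF y0, where w = "\<lambda>l. 40 / y\<^sup>2 * \<bar>pairing_density u g l\<bar>"])
    show "integrable (spec u) (\<lambda>l. 40 / y\<^sup>2 * \<bar>pairing_density u g l\<bar>)" by (rule iH)
    fix x assume x: "x \<in> {y / 2<..<2 * y}"
    show "integrable (spec u) (\<lambda>l. extension_profile' s x l * pairing_density u g l)"
      by (rule integrable_mult_dens[OF u g _ extension_profile'_bounded[OF s pos[OF x]]]) simp
    fix l
    show "((\<lambda>y. extension_profile' s y l * pairing_density u g l) has_real_derivative extension_profile'' s x l * pairing_density u g l) (at x)"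
      by (rule DERIV_cmult_right[OF extension_profile'_has_derivative[OF pos[OF x]]])
    have "(y / 2)\<^sup>2 \<le> x\<^sup>2" using x y by (intro power_mono) auto
    then have "10 / x\<^sup>2 \<le> 40 / y\<^sup>2" using y pos[OF x] by (simp add: field_simps)
    then have "\<bar>extension_profile'' s x l\<bar> \<le> 40 / y\<^sup>2"
      using extension_profile''_bounded[OF s pos[OF x], of l] by linarith
    then show "\<bar>extension_profile'' s x l * pairing_density u g l\<bar> \<le> 40 / y\<^sup>2 * \<bar>pairing_density u g l\<bar>"
      unfolding abs_mult by (rule mult_right_mono) simp
  qed simp
qed

lemma extension_pairing_ODE:
  assumes u: "u \<in> L2 M" and g: "g \<in> L2 M" and s: "0 < s" and y: "0 < y"
  shows "(LINT l|spec u. extension_profile'' s y l * pairing_density u g l)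
      + (1 - 2 * s) / y * (LINT l|spec u. extension_profile' s y l * pairing_density u g l)
    = ip (spec u) (\<lambda>l. l * extension_profile s y l) (pairing_density u g)"
proof -
  have i1: "integrable (spec u) (\<lambda>l. extension_profile' s y l * pairing_density u g l)"
    by (rule integrable_mult_dens[OF u g _ extension_profile'_bounded[OF s y]]) simp
  have i2: "integrable (spec u) (\<lambda>l. extension_profile'' s y l * pairing_density u g l)"
    by (rule integrable_mult_dens[OF u g _ extension_profile''_bounded[OF s y]]) simp
  have "ip (spec u) (\<lambda>l. l * extension_profile s y l) (pairing_density u g)
     = (LINT l|spec u. extension_profile'' s y l * pairing_density u g l
      + (1 - 2 * s) / y * (extension_profile' s y l * pairing_density u g l))"
    unfolding ip_def extension_profile_ODE[OF y, symmetric] by (simp add: algebra_simps)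
  also have "\<dots> = (LINT l|spec u. extension_profile'' s y l * pairing_density u g l)
      + (1 - 2 * s) / y * (LINT l|spec u. extension_profile' s y l * pairing_density u g l)"
    using i1 i2 by simp
  finally show ?thesis by simp
qed

lemma extension_pairing_tendsto:
  assumes u: "u \<in> L2 M" and g: "g \<in> L2 M" and s: "0 < s"
  shows "((\<lambda>y. LINT l|spec u. extension_profile s y l * pairing_density u g l)
    \<longlongrightarrow> (LINT l|spec u. indicator {0<..} l * pairing_density u g l)) (at_right 0)"
  unfolding tendsto_at_iff_sequentially comp_def
proof (intro allI impI)
  note [measurable] = dens_measurable[OF u g]
  fix X :: "nat \<Rightarrow> real"
  assume X: "\<forall>i. X i \<in> {0<..} - {0}" "X \<longlonglongrightarrow> 0"
  have X0: "0 < X n" for n using X(1) by auto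
  have G: "0 < Gamma s" using s by (simp add: Gamma_real_pos)
  show "(\<lambda>n. LINT l|spec u. extension_profile s (X n) l * pairing_density u g l)
      \<longlonglongrightarrow> (LINT l|spec u. indicator {0<..} l * pairing_density u g l)"
  proof (rule integral_dominated_convergence[where w = "\<lambda>l. \<bar>pairing_density u g l\<bar>"])
    show "integrable (spec u) (\<lambda>l. \<bar>pairing_density u g l\<bar>)"
      using L2_spec_integrable[OF u dens_L2[OF u g]] by simp
    show "AE l in spec u. (\<lambda>n. extension_profile s (X n) l * pairing_density u g l) \<longlonglongrightarrow> indicator {0<..} l * pairing_density u g l"
    proof (rule AE_I2)
      fix l :: real
      show "(\<lambda>n. extension_profile s (X n) l * pairing_density u g l) \<longlonglongrightarrow> indicator {0<..} l * pairing_density u g l"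
      proof (cases "0 < l")
        case True
        have "(\<lambda>n. (X n)\<^sup>2 * l) \<longlonglongrightarrow> 0\<^sup>2 * l" by (intro tendsto_intros X)
        then have "(\<lambda>n. bessel_K s ((X n)\<^sup>2 * l)) \<longlonglongrightarrow> Gamma s"
          using True by (intro bessel_K_tendsto_Gamma[OF s]) auto
        then have "(\<lambda>n. bessel_K s ((X n)\<^sup>2 * l) / Gamma s * pairing_density u g l) \<longlonglongrightarrow> Gamma s / Gamma s * pairing_density u g l"
          using G by (intro tendsto_intros) auto
        then show ?thesis using True G by (simp add: extension_profile_def)
      qed (simp add: extension_profile_def)
    qed
    show "AE l in spec u. norm (extension_profile s (X n) l * pairing_density u g l) \<le> \<bar>pairing_density u g l\<bar>" for n
      using extension_profile_bounded[OF s X0[of n]]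
      by (auto simp: abs_mult intro!: mult_left_le_one_le)
  qed simp_all
qed

text \<open>
  The majorant is \<open>\<Gamma>(1 - s) \<lambda>\<^sup>s \<bar>h\<bar>\<close>, which is integrable because \<open>\<lambda>\<^sup>s\<close> and the density \<open>h\<close> both lie in
  \<open>L\<^sup>2(m)\<close>.
\<close>

lemma weighted_derivative_tendsto:
  assumes u: "u \<in> L2 M" and g: "g \<in> L2 M" and s: "0 < s" "s < 1"
    and dom: "(\<lambda>l. l powr s) \<in> L2 (spec u)"
  shows "((\<lambda>y. y powr (1 - 2 * s) * (LINT l|spec u. extension_profile' s y l * pairing_density u g l))
    \<longlongrightarrow> - (2 powr (1 - 2 * s) * Gamma (1 - s) / Gamma s) * ip (spec u) (\<lambda>l. l powr s) (pairing_density u g))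
    (at_right 0)"
  unfolding tendsto_at_iff_sequentially comp_def
proof (intro allI impI)
  note [measurable] = dens_measurable[OF u g]
  fix X :: "nat \<Rightarrow> real"
  assume X: "\<forall>i. X i \<in> {0<..} - {0}" "X \<longlonglongrightarrow> 0"
  have X0: "0 < X n" for n using X(1) by auto
  let ?c = "- (2 powr (1 - 2 * s) / Gamma s)"
  let ?K = "\<lambda>n l. indicator {0<..} l * (l powr s * bessel_K (1 - s) ((X n)\<^sup>2 * l)) * pairing_density u g l"
  have "(\<lambda>n. LINT l|spec u. ?K n l) \<longlonglongrightarrow> (LINT l|spec u. Gamma (1 - s) * (l powr s * pairing_density u g l))"
  proof (rule integral_dominated_convergence[where w = "\<lambda>l. Gamma (1 - s) * \<bar>l powr s * pairing_density u g l\<bar>"])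
    show "integrable (spec u) (\<lambda>l. Gamma (1 - s) * \<bar>l powr s * pairing_density u g l\<bar>)"
      using L2_integrable_mult[OF dom dens_L2[OF u g]] by (intro integrable_mult_right) simp
    show "AE l in spec u. (\<lambda>n. ?K n l) \<longlonglongrightarrow> Gamma (1 - s) * (l powr s * pairing_density u g l)"
      using AE_spec_nonneg[OF u]
    proof eventually_elim
      case (elim l)
      show ?case
      proof (cases "l = 0")
        case False
        then have l: "0 < l" using elim by simp
        have "(\<lambda>n. (X n)\<^sup>2 * l) \<longlonglongrightarrow> 0\<^sup>2 * l" by (intro tendsto_intros X)
        then have "(\<lambda>n. bessel_K (1 - s) ((X n)\<^sup>2 * l)) \<longlonglongrightarrow> Gamma (1 - s)"
          using l s by (intro bessel_K_tendsto_Gamma) auto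
        then have "(\<lambda>n. bessel_K (1 - s) ((X n)\<^sup>2 * l) * (l powr s * pairing_density u g l))
            \<longlonglongrightarrow> Gamma (1 - s) * (l powr s * pairing_density u g l)"
          by (intro tendsto_intros)
        then show ?thesis using l by (simp add: mult_ac)
      qed simp
    qed
    show "AE l in spec u. norm (?K n l) \<le> Gamma (1 - s) * \<bar>l powr s * pairing_density u g l\<bar>" for n
    proof (rule AE_I2)
      fix l :: real
      show "norm (?K n l) \<le> Gamma (1 - s) * \<bar>l powr s * pairing_density u g l\<bar>"
      proof (cases "0 < l")
        case True
        have "bessel_K (1 - s) ((X n)\<^sup>2 * l) \<le> Gamma (1 - s)"
          using True s by (intro bessel_K_le_Gamma) auto
        then have "bessel_K (1 - s) ((X n)\<^sup>2 * l) * \<bar>l powr s * pairing_density u g l\<bar> \<le> Gamma (1 - s) * \<bar>l powr s * pairing_density u g l\<bar>"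
          by (rule mult_right_mono) simp
        then show ?thesis using True by (simp add: abs_mult bessel_K_nonneg mult_ac)
      qed (use s in \<open>simp add: Gamma_real_nonneg\<close>)
    qed
  qed simp_all
  from tendsto_mult_left[OF this, of ?c]
  have lim: "(\<lambda>n. ?c * (LINT l|spec u. ?K n l)) \<longlonglongrightarrow> ?c * (LINT l|spec u. Gamma (1 - s) * (l powr s * pairing_density u g l))" .
  have eq: "(X n) powr (1 - 2 * s) * (LINT l|spec u. extension_profile' s (X n) l * pairing_density u g l)
      = ?c * (LINT l|spec u. ?K n l)" for n
  proof -
    have "(X n) powr (1 - 2 * s) * (LINT l|spec u. extension_profile' s (X n) l * pairing_density u g l)
        = (LINT l|spec u. ((X n) powr (1 - 2 * s) * extension_profile' s (X n) l) * pairing_density u g l)"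
      by (subst integral_mult_right_zero[symmetric]) (simp only: mult.assoc)
    also have "\<dots> = (LINT l|spec u. ?c * ?K n l)"
      unfolding extension_profile'_weighted[OF X0] by (simp only: mult.assoc)
    also have "\<dots> = ?c * (LINT l|spec u. ?K n l)" by (rule integral_mult_right_zero)
    finally show ?thesis .
  qed
  have val: "?c * (LINT l|spec u. Gamma (1 - s) * (l powr s * pairing_density u g l))
    = - (2 powr (1 - 2 * s) * Gamma (1 - s) / Gamma s) * ip (spec u) (\<lambda>l. l powr s) (pairing_density u g)"
    by (simp add: ip_def)
  show "(\<lambda>n. X n powr (1 - 2 * s) * (LINT l|spec u. extension_profile' s (X n) l * pairing_density u g l))
     \<longlonglongrightarrow> - (2 powr (1 - 2 * s) * Gamma (1 - s) / Gamma s) * ip (spec u) (\<lambda>l. l powr s) (pairing_density u g)"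
    unfolding eq val[symmetric] by (rule lim)
qed

lemma ex_extension_represents:
  assumes u: "u \<in> L2 M" and s: "0 < s" and y: "0 < y"
  shows "\<exists>v. represents (extension_profile s y) u v"
  by (rule ex_represents[OF u bounded_L2_spec[OF u _ extension_profile_bounded[OF s y]]]) simp

lemma frac_power_represents:
  assumes u: "u \<in> L2 M" and dom: "(\<lambda>l. l powr s) \<in> L2 (spec u)"
  shows "represents (\<lambda>l. l powr s) u (frac_power M Q s u)"
  using spectral_op_represents[OF u represents_one[OF u], of "\<lambda>l. l powr s"] dom
  by (simp add: frac_power_def)

lemma extension_weak_integral:
  assumes u: "u \<in> L2 M" and dom: "(\<lambda>l. l powr s) \<in> L2 (spec u)" and s: "0 < s" and y: "0 < y"
    and v: "represents (extension_profile s y) u v"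
  shows "has_weak_integral M (1 / Gamma s) (\<lambda>t. heat M Q t (frac_power M Q s u))
     (\<lambda>t. exp (- y\<^sup>2 / (4 * t)) / t powr (1 - s)) v"
proof (rule has_weak_integral_heat[OF u frac_power_represents[OF u dom] _ _ _ v])
  have k: "exp (- y\<^sup>2 / (4 * t)) / t powr (1 - s) = exp (- (y\<^sup>2 / 4) / t) * t powr (s - 1)" for t
    using powr_minus_divide[of t "1 - s"] by simp
  have b: "0 < y\<^sup>2 / 4" using y by simp
  show "AE l in spec u. l powr s = 0 \<or>
      set_integrable lborel {0<..} (\<lambda>t. exp (- (t * l)) * (exp (- y\<^sup>2 / (4 * t)) / t powr (1 - s)))"
    using AE_spec_nonneg[OF u]
  proof eventually_elim
    case (elim l)
    then show ?case
      unfolding k using scaled_kernel_integrable[OF _ b, of l s] by (cases "l = 0") auto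
  qed
  show "AE l in spec u. extension_profile s y l = 1 / Gamma s * (l powr s *
      (LINT t:{0<..}|lborel. exp (- (t * l)) * (exp (- y\<^sup>2 / (4 * t)) / t powr (1 - s))))"
    using AE_spec_nonneg[OF u]
  proof eventually_elim
    case (elim l)
    show ?case
    proof (cases "l = 0")
      case False
      then have l: "0 < l" using elim by simp
      have "l powr s * l powr (- s) = 1" using l by (simp add: powr_add[symmetric])
      then show ?thesis
        unfolding k scaled_kernel_integral[OF l b] using l
        by (simp add: extension_profile_def mult.assoc[symmetric])
    qed (simp add: extension_profile_def)
  qed
  show "1 / Gamma s \<noteq> 0" using s by (simp add: Gamma_real_pos less_imp_neq[symmetric])
qed auto

text \<open>
  Here the inner integral is \<open>\<lambda>\<^sup>s K\<^sub>-\<^sub>s(y\<^sup>2 \<lambda>)\<close>, and the reflection formula identifies its multiple by the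
  Poisson constant with the profile. At \<open>\<lambda> = 0\<close> this multiple is \<open>1\<close> while the profile is \<open>0\<close>, so
  that point has to be a null set.
\<close>

lemma Poisson_weak_integral:
  assumes u: "u \<in> L2 M" and pos: "AE l in spec u. 0 < l" and s: "0 < s" and y: "0 < y"
    and v: "represents (extension_profile s y) u v"
  shows "has_weak_integral M (y powr (2 * s) / (2 powr (2 * s) * Gamma s)) (\<lambda>t. heat M Q t u)
     (\<lambda>t. exp (- y\<^sup>2 / (4 * t)) / t powr (1 + s)) v"
proof (rule has_weak_integral_heat[OF u represents_one[OF u] _ _ _ v])
  have k: "exp (- y\<^sup>2 / (4 * t)) / t powr (1 + s) = exp (- (y\<^sup>2 / 4) / t) * t powr (- s - 1)" for t
  proof -
    have "- s - 1 = - (1 + s)" by simp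
    then show ?thesis by (simp only: powr_minus_divide) simp
  qed
  have b: "0 < y\<^sup>2 / 4" using y by simp
  show "AE l in spec u. (1 :: real) = 0 \<or>
      set_integrable lborel {0<..} (\<lambda>t. exp (- (t * l)) * (exp (- y\<^sup>2 / (4 * t)) / t powr (1 + s)))"
    using pos
  proof eventually_elim
    case (elim l)
    then show ?case unfolding k using scaled_kernel_integrable[OF _ b, of l "- s"] by auto
  qed
  show "AE l in spec u. extension_profile s y l = y powr (2 * s) / (2 powr (2 * s) * Gamma s) * (1 *
      (LINT t:{0<..}|lborel. exp (- (t * l)) * (exp (- y\<^sup>2 / (4 * t)) / t powr (1 + s))))"
    using pos
  proof eventually_elim
    case (elim l)
    have "bessel_K s (y\<^sup>2 * l) = (y\<^sup>2 * l / 4) powr s * bessel_K (- s) (y\<^sup>2 * l)"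
      using elim y by (intro bessel_K_reflection) simp
    moreover have "(y\<^sup>2 * l / 4) powr s = y powr (2 * s) * l powr s / 2 powr (2 * s)"
      using elim y powr_powr[of y 2 s] powr_powr[of 2 2 s] by (simp add: powr_divide powr_mult)
    ultimately show ?case
      unfolding k scaled_kernel_integral[OF elim b] using elim
      by (simp add: extension_profile_def)
  qed
  show "y powr (2 * s) / (2 powr (2 * s) * Gamma s) \<noteq> 0"
    using s y by (simp add: Gamma_real_pos less_imp_neq[symmetric])
qed auto

text \<open>
  Any two weak integrals of the same integrand have equal pairings, so the representative chosen by
  \<^const>\<open>extension\<close> is represented by the profile, as is the one constructed here.
\<close>

lemma extension_represents:
  assumes u: "u \<in> L2 M" and dom: "(\<lambda>l. l powr s) \<in> L2 (spec u)" and s: "0 < s" and y: "0 < y"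
  shows "represents (extension_profile s y) u (extension M Q s u y)"
proof -
  obtain v where v: "represents (extension_profile s y) u v"
    using ex_extension_represents[OF u s y] by blast
  from extension_weak_integral[OF u dom s y v]
  have e: "has_weak_integral M (1 / Gamma s) (\<lambda>t. heat M Q t (frac_power M Q s u))
     (\<lambda>t. exp (- y\<^sup>2 / (4 * t)) / t powr (1 - s)) (extension M Q s u y)"
    unfolding extension_def
    by (rule someI[where P = "has_weak_integral M (1 / Gamma s) (\<lambda>t. heat M Q t (frac_power M Q s u))
     (\<lambda>t. exp (- y\<^sup>2 / (4 * t)) / t powr (1 - s))"])
  with extension_weak_integral[OF u dom s y v] v show ?thesis
    by (auto simp: represents_def has_weak_integral_def)
qed

text \<open>
  The projection \<open>Q {0} u\<close> lies in the kernel of \<open>L\<close>, so orthogonality gives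
  \<open>m\<^sub>u{0} = \<langle>Q {0} u, u\<rangle> = 0\<close>.
\<close>

lemma AE_spec_pos:
  assumes u: "u \<in> L2 M" and D: "spectral_resolution M D (\<lambda>u x. - L u x) Q"
    and lin: "linear_L2 M D L" and orth: "orthogonal_to_kernel M D L u"
  shows "AE l in spec u. 0 < l"
proof -
  let ?w = "Q {0} u"
  have w: "represents (indicator {0}) u ?w" by (rule represents_indicator[OF u]) simp
  have z: "(\<lambda>l. l * indicator {0} l) = (\<lambda>l. 0 :: real)" by (auto simp: indicator_def)
  have zL: "(\<lambda>l. l * indicator {0} l) \<in> L2 (spec u)" unfolding z by (rule L2_zero)
  have "?w \<in> spectral_domain M Q (\<lambda>l. l)"
    by (rule spectral_domain_represents[OF u w _ zL]) simp
  then have wD: "?w \<in> D" using D by (simp add: spectral_resolution_def)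
  have LwL: "L ?w \<in> L2 M" using lin wD by (auto simp: linear_L2_def)
  have "ip M (\<lambda>x. - L ?w x) (L ?w) = spectral_integral M Q (\<lambda>l. l) ?w (L ?w)"
    using D wD LwL by (simp add: spectral_resolution_def)
  also have "\<dots> = ip (spec u) (\<lambda>l. l * indicator {0} l) (pairing_density u (L ?w))"
    by (rule spectral_integral_represents[OF u w LwL _ zL]) simp
  also have "\<dots> = 0" unfolding z by (simp add: ip_def)
  finally have "ip M (L ?w) (L ?w) = 0" by (simp add: ip_def)
  then have "AE x in M. L ?w x = 0" by (rule ip_self_eq_0_AE[OF LwL])
  then have "ip M u ?w = 0" using orth wD by (simp add: orthogonal_to_kernel_def)
  then have "emeasure (spec u) {0} = 0" by (simp add: emeasure_spec[OF u] ip_commute)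
  then have "{0} \<in> null_sets (spec u)" by (auto simp: null_sets_def)
  then have "AE l in spec u. l \<noteq> 0" by (rule AE_I') auto
  with AE_spec_nonneg[OF u] show ?thesis by eventually_elim simp
qed

lemma powr_L2_spec:
  assumes "(\<integral>\<^sup>+ l. ennreal (l powr (2 * s)) \<partial>spec u) < \<infinity>"
  shows "(\<lambda>l. l powr s) \<in> L2 (spec u)"
proof -
  have "(l powr s)\<^sup>2 = l powr (2 * s)" for l :: real
    by (simp add: power2_eq_square powr_add[symmetric])
  moreover have "integrable (spec u) (\<lambda>l. l powr (2 * s))"
    by (rule integrableI_nonneg) (use assms in auto)
  ultimately show ?thesis by (simp add: L2_def)
qed

end

text \<open>
  For \<open>y > 0\<close> the function \<open>\<lambda> K\<^sub>s(y\<^sup>2 \<lambda>)\<close> is bounded, which puts \<open>U y\<close> into the domain of \<open>L\<close>. There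
  \<open>- L\<close> is multiplication by \<open>\<lambda>\<close>, so the equation is the integral of the differential equation of
  the profile.
\<close>

lemma weak_equation_extension:
  assumes pvm: "projection_valued_measure M Q" and D: "spectral_resolution M D (\<lambda>u x. - L u x) Q"
    and lin: "linear_L2 M D L" and f: "f \<in> L2 M" and s: "0 < s"
    and U: "\<And>y. 0 < y \<Longrightarrow> projection_valued_measure.represents M Q (extension_profile s y) f (U y)"
  shows "weak_equation M D L (1 - 2 * s) U"
    and "\<And>g y. g \<in> L2 M \<Longrightarrow> 0 < y \<Longrightarrow> deriv (\<lambda>y. ip M (U y) g) y
      = (LINT l|spectral_measure M Q f. extension_profile' s y l * projection_valued_measure.pairing_density M Q f g l)"
proof -
  interpret projection_valued_measure M Q by (rule pvm)
  let ?N = "\<lambda>g y. LINT l|spec f. extension_profile s y l * pairing_density f g l"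
  let ?N' = "\<lambda>g y. LINT l|spec f. extension_profile' s y l * pairing_density f g l"
  let ?N'' = "\<lambda>g y. LINT l|spec f. extension_profile'' s y l * pairing_density f g l"
  have ipU: "ip M (U y) g = ?N g y" if "0 < y" "g \<in> L2 M" for g y
    using representsD(3)[OF U[OF that(1)] that(2)] by (simp add: ip_def)
  have d1: "((\<lambda>y. ip M (U y) g) has_real_derivative ?N' g y) (at y)" if g: "g \<in> L2 M" and y: "0 < y" for g y
    by (rule has_field_derivative_transform_within_open[where S = "{0<..}",
          OF extension_pairing_has_derivative[OF f g s y]])
       (use y g in \<open>auto simp: ipU\<close>)
  then show der: "deriv (\<lambda>y. ip M (U y) g) y = ?N' g y" if "g \<in> L2 M" "0 < y" for g y
    using that by (intro DERIV_imp_deriv) auto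
  have d2: "(deriv (\<lambda>y. ip M (U y) g) has_real_derivative ?N'' g y) (at y)" if g: "g \<in> L2 M" and y: "0 < y" for g y
    by (rule has_field_derivative_transform_within_open[where S = "{0<..}",
          OF extension_pairing_has_second_derivative[OF f g s y]])
       (use y g in \<open>auto simp: der\<close>)
  show "weak_equation M D L (1 - 2 * s) U"
    unfolding weak_equation_def
  proof (intro allI impI conjI ballI)
    fix y :: real assume y: "0 < y"
    have L2: "(\<lambda>l. l * extension_profile s y l) \<in> L2 (spec f)"
      by (rule bounded_L2_spec[OF f _ mult_extension_profile_bounded[OF s y]]) simp
    have "U y \<in> spectral_domain M Q (\<lambda>l. l)"
      by (rule spectral_domain_represents[OF f U[OF y] _ L2]) simp
    then show UD: "U y \<in> D" using D by (simp add: spectral_resolution_def)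
    fix g assume g: "g \<in> L2 M"
    show "(\<lambda>y. ip M (U y) g) field_differentiable at y"
      using d1[OF g y] by (auto simp: field_differentiable_def)
    show "deriv (\<lambda>y. ip M (U y) g) field_differentiable at y"
      using d2[OF g y] by (auto simp: field_differentiable_def)
    have "ip M (\<lambda>x. - L (U y) x) g = spectral_integral M Q (\<lambda>l. l) (U y) g"
      using D UD g by (simp add: spectral_resolution_def)
    also have "\<dots> = ip (spec f) (\<lambda>l. l * extension_profile s y l) (pairing_density f g)"
      by (rule spectral_integral_represents[OF f U[OF y] g _ L2]) simp
    finally have "ip M (L (U y)) g = - ip (spec f) (\<lambda>l. l * extension_profile s y l) (pairing_density f g)"
      by (simp add: ip_def)
    then show "ip M (L (U y)) g + bessel_op (1 - 2 * s) (\<lambda>y. ip M (U y) g) y = 0"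
      using extension_pairing_ODE[OF f g s y]
      by (simp add: bessel_op_def der[OF g y] DERIV_imp_deriv[OF d2[OF g y]])
  qed
qed

theorem theorem3p1:
  fixes M :: "'a::polish_space measure"
    and \<F> :: "('a \<Rightarrow> real) set"
    and \<E> :: "('a \<Rightarrow> real) \<Rightarrow> ('a \<Rightarrow> real) \<Rightarrow> real"
    and D :: "('a \<Rightarrow> real) set"
    and L :: "('a \<Rightarrow> real) \<Rightarrow> ('a \<Rightarrow> real)"
    and Q :: "real set \<Rightarrow> ('a \<Rightarrow> real) \<Rightarrow> ('a \<Rightarrow> real)"
    and s a :: real
    and f :: "'a \<Rightarrow> real"
    and U :: "real \<Rightarrow> 'a \<Rightarrow> real"
  assumes "strongly_local_regular_dirichlet_form M \<F> \<E>"
    and "generator M \<F> \<E> D L Q"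
    and "0 < s" and "s < 1" and "a = 1 - 2 * s"
    and "f \<in> frac_domain M \<F> Q s"
    and "U = extension M Q s f"
  shows
    "(\<forall>y>0. has_weak_integral M (1 / Gamma s)
        (\<lambda>t. heat M Q t (frac_power M Q s f))
        (\<lambda>t. exp (- y\<^sup>2 / (4 * t)) / t powr (1 - s)) (U y)) \<and>
     weak_equation M D L a U \<and>
     (orthogonal_to_kernel M D L f \<longrightarrow> weak_solution M D L a f U) \<and>
     (orthogonal_to_kernel M D L f \<longrightarrow>
       (\<forall>y>0. has_weak_integral M (y powr (2 * s) / (2 powr (2 * s) * Gamma s))
          (\<lambda>t. heat M Q t f)
          (\<lambda>t. exp (- y\<^sup>2 / (4 * t)) / t powr (1 + s)) (U y))) \<and>
     (\<forall>g\<in>L2 M. \<exists>l.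
        ((\<lambda>y. y powr a * deriv (\<lambda>y. ip M (U y) g) y) \<longlongrightarrow> l) (at_right 0) \<and>
        ip M (frac_power M Q s f) g =
          - (2 powr (2 * s - 1) * Gamma s / Gamma (1 - s)) * l)"
proof -
  have lin: "linear_L2 M D L" and D: "spectral_resolution M D (\<lambda>u x. - L u x) Q"
    and \<F>: "\<F> = spectral_domain M Q sqrt"
    using assms(2) by (auto simp: generator_def self_adjoint_def)
  have pvm: "projection_valued_measure M Q"
    using D by unfold_locales (simp add: spectral_resolution_def)
  interpret projection_valued_measure M Q by (rule pvm)
  note s = assms(3,4) and a = assms(5)
  have f: "f \<in> L2 M" using assms(6) by (simp add: frac_domain_def \<F> spectral_domain_def)
  have dom: "(\<lambda>l. l powr s) \<in> L2 (spec f)"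
    using assms(6) by (intro powr_L2_spec) (simp add: frac_domain_def)
  have U: "represents (extension_profile s y) f (U y)" if "0 < y" for y
    unfolding assms(7) by (rule extension_represents[OF f dom s(1) that])
  have eq: "weak_equation M D L a U"
    and der: "\<And>g y. g \<in> L2 M \<Longrightarrow> 0 < y \<Longrightarrow> deriv (\<lambda>y. ip M (U y) g) y
      = (LINT l|spec f. extension_profile' s y l * pairing_density f g l)"
    unfolding a using weak_equation_extension[OF pvm D lin f s(1) U] by auto
  have bdry: "weak_boundary_value M f U" if "orthogonal_to_kernel M D L f"
    unfolding weak_boundary_value_def
  proof
    fix g assume g: "g \<in> L2 M"
    have "(LINT l|spec f. indicator {0<..} l * pairing_density f g l) = (LINT l|spec f. 1 * pairing_density f g l)"
      by (rule integral_cong_AE)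
        (use AE_spec_pos[OF f D lin that] dens_measurable[OF f g] in \<open>auto\<close>)
    also have "\<dots> = ip M f g"
      using representsD(3)[OF represents_one[OF f] g] by (simp add: ip_def)
    finally have "((\<lambda>y. LINT l|spec f. extension_profile s y l * pairing_density f g l) \<longlongrightarrow> ip M f g) (at_right 0)"
      using extension_pairing_tendsto[OF f g s(1)] by simp
    moreover have "eventually (\<lambda>y. (LINT l|spec f. extension_profile s y l * pairing_density f g l) = ip M (U y) g) (at_right 0)"
      using eventually_at_right_less[of 0]
      by eventually_elim (use representsD(3)[OF U g] in \<open>simp add: ip_def\<close>)
    ultimately show "((\<lambda>y. ip M (U y) g) \<longlongrightarrow> ip M f g) (at_right 0)"
      by (rule Lim_transform_eventually)
  qed
  have neumann: "\<exists>l. ((\<lambda>y. y powr a * deriv (\<lambda>y. ip M (U y) g) y) \<longlongrightarrow> l) (at_right 0) \<and>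
        ip M (frac_power M Q s f) g = - (2 powr (2 * s - 1) * Gamma s / Gamma (1 - s)) * l"
    if g: "g \<in> L2 M" for g
  proof (intro exI conjI)
    let ?l = "- (2 powr (1 - 2 * s) * Gamma (1 - s) / Gamma s) * ip (spec f) (\<lambda>l. l powr s) (pairing_density f g)"
    have "eventually (\<lambda>y. y powr (1 - 2 * s) * (LINT l|spec f. extension_profile' s y l * pairing_density f g l)
        = y powr a * deriv (\<lambda>y. ip M (U y) g) y) (at_right 0)"
      using eventually_at_right_less[of 0] by eventually_elim (simp add: der[OF g] a)
    from Lim_transform_eventually[OF weighted_derivative_tendsto[OF f g s dom] this]
    show "((\<lambda>y. y powr a * deriv (\<lambda>y. ip M (U y) g) y) \<longlongrightarrow> ?l) (at_right 0)" .
    have "0 < Gamma s" "0 < Gamma (1 - s)" using s by (auto intro!: Gamma_real_pos)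
    moreover have "(2 :: real) powr (2 * s - 1) * 2 powr (1 - 2 * s) = 1"
      by (simp add: powr_add[symmetric])
    ultimately have "ip (spec f) (\<lambda>l. l powr s) (pairing_density f g)
        = - (2 powr (2 * s - 1) * Gamma s / Gamma (1 - s)) * ?l"
      by (simp add: mult_ac)
    then show "ip M (frac_power M Q s f) g = - (2 powr (2 * s - 1) * Gamma s / Gamma (1 - s)) * ?l"
      using representsD(3)[OF frac_power_represents[OF f dom] g] by simp
  qed
  show ?thesis
    using extension_weak_integral[OF f dom s(1) _ U] eq bdry
      Poisson_weak_integral[OF f AE_spec_pos[OF f D lin] s(1) _ U] neumann
    by (simp add: weak_solution_def)
qed

end
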